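(* Let $f_1,\dots,f_n:\mathbb{R}^p\to\mathbb{R}$ be twice differentiable and $F(\mathbf{x})=\frac1n\sum_{i=1}^n f_i(\mathbf{x})$. Assume that there are constants $0<K_i<\infty$ with $0\preceq\nabla^2 f_i(\mathbf{x})\preceq K_i\mathbb{I}$ for all $\mathbf{x}\in\mathbb{R}^p$ and $i=1,\dots,n$, and constants $0<\gamma\le K<\infty$ with $\gamma\mathbb{I}\preceq\nabla^2F(\mathbf{x})\preceq K\mathbb{I}$ for all $\mathbf{x}\in\mathbb{R}^p$; let $\mathbf{x}^*$ be the minimizer of $F$. Let $0\le\theta_1<1$, $0\le\theta_2<1$, $0<\delta<1$, $0<\epsilon<1$, $0<\beta<1$, $\widehat\alpha\ge1$ be given. For any $\mathbf{x}^{(k)}\in\mathbb{R}^p$, let $\mathbf{x}^{(k+1)}$ be obtained from $\mathbf{x}^{(k)}$ by one iteration of the inexact sub-sampled Newton algorithm described in the context (sub-sampled Hessian, full gradient, inexact update with tolerances $\theta_1,\theta_2$). Then, with probability $1-\delta$, $$F(\mathbf{x}^{(k+1)})-F(\mathbf{x}^* )\le(1-\rho)\big(F(\mathbf{x}^{(k)})-F(\mathbf{x}^* )\big),$$ where (i) if $\theta_1\le\sqrt{\frac{1-\epsilon}{4\tilde\kappa}}$, then $\rho=\frac{\alpha_k\beta}{\tilde\kappa}$; (ii) otherwise, $\rho=\frac{2(1-\theta_2)(1-\theta_1)^2(1-\epsilon)\alpha_k\beta}{\tilde\kappa^2}$. Moreover, in both cases, the step size is at least $$\alpha_k\ge\f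rac{2(1-\theta_2)(1-\beta)(1-\epsilon)}{\kappa}.$$
   Context: Condition numbers: $\kappa=K/\gamma$. For an integer $1\le q\le n$, $\widehat K_q$ is the average of the $q$ largest values among $K_1,\dots,K_n$, and $\kappa_q=\widehat K_q/\gamma$. For a sample $\mathcal{S}$, $\tilde\kappa=\kappa_1$ if $\mathcal{S}$ is drawn with replacement, and $\tilde\kappa=\kappa_{|\mathcal{S}|}$ if it is drawn without replacement. Algorithm (one iteration). The sample size satisfies $|\mathcal{S}|\ge 2\kappa_1\ln(p/\delta)/\epsilon^2$. A collection $\mathcal{S}$ of $|\mathcal{S}|$ indices is drawn from $\{1,\dots,n\}$ uniformly at random, with or without replacement, and $H(\mathbf{x}^{(k)})=\frac1{|\mathcal{S}|}\sum_{j\in\mathcal{S}}\nabla^2f_j(\mathbf{x}^{(k)})$. Then $\mathbf{x}^{(k+1)}=\mathbf{x}^{(k)}+\alpha_k\mathbf{p}_k$, where $\mathbf{p}_k$ is any vector satisfying both $$\|H(\mathbf{x}^{(k)})\mathbf{p}_k+\nabla F(\mathbf{x}^{(k)})\|\le\theta_1\|\nabla F(\mathbf{x}^{(k)})\|,\qquad \mathbf{p}_k^T\nabla F(\mathbf{x}^{(k)})\le-(1-\theta_2)\,\mathbf{p}_k^TH(\mathbf{x}^{(k)})\mathbf{p}_k,$$ and $\alpha_k$ is the largest $\alpha\le\widehat\alpha$ such that $F(\mathbf{x}^{(k)}+\alpha\mathbf{p}_k)\le F(\mathbf{x}^{(k)})+\alpha\beta\,\mathbf{p}_k^T\nabla F(\mathbf{x}^{(k)})$.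 "With probability $1-\delta$" means with probability at least $1-\delta$ over the draw of $\mathcal{S}$, and refers to all conclusions. $A\preceq B$ means $B-A$ is symmetric positive semi-definite.
   Formalization: The step-size bound is proved as α_k ≥ min(α̂, 2(1−θ₂)(1−β)(1−ε)/κ): since α_k ≤ α̂, the stated bound fails when it exceeds α̂ (e.g. f₁(x)=x²/2, α̂=1, θ₁=θ₂=0, ε=β=1/4, where α_k=1 < 9/8). *)

theory Defs
  imports "HOL-Probability.Probability"
begin

definition grad :: "(real^'p \<Rightarrow> real) \<Rightarrow> real^'p \<Rightarrow> real^'p" where
  "grad f x = (THE g. GDERIV f x :> g)"

definition hessian :: "(real^'p \<Rightarrow> real) \<Rightarrow> real^'p \<Rightarrow> real^'p^'p" where
  "hessian f x = jacobian (grad f) (at x)"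

definition twice_differentiable :: "(real^'p \<Rightarrow> real) \<Rightarrow> bool" where
  "twice_differentiable f \<longleftrightarrow>
     (\<forall>x. f differentiable (at x)) \<and> (\<forall>x. grad f differentiable (at x))"

definition sym_psd :: "real^'p^'p \<Rightarrow> bool" where
  "sym_psd A \<longleftrightarrow> transpose A = A \<and> (\<forall>v. 0 \<le> v \<bullet> (A *v v))"

definition loewner_le :: "real^'p^'p \<Rightarrow> real^'p^'p \<Rightarrow> bool"  (infix \<open>\<preceq>\<close> 50) where
  "A \<preceq> B \<longleftrightarrow> sym_psd (B - A)"

definition average :: "nat \<Rightarrow> (nat \<Rightarrow> real^'p \<Rightarrow> real) \<Rightarrow> real^'p \<Rightarrow> real" where
  "average n f x = (1 / real n) * (\<Sum>i=1..n. f i x)"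

(* average of the q largest among Ks 1, ..., Ks n; meant for 1 <= q <= n *)
definition K_hat :: "nat \<Rightarrow> (nat \<Rightarrow> real) \<Rightarrow> nat \<Rightarrow> real" where
  "K_hat n Ks q = sum_list (take q (rev (sort (map Ks [1..<Suc n])))) / real q"

datatype sampling = With_Replacement | Without_Replacement

(* A sample of size m is recorded as the list of the m drawn indices, in drawing order.
   Without replacement, m <= n is needed for the set of admissible lists to be nonempty. *)
fun sample_lists :: "sampling \<Rightarrow> nat \<Rightarrow> nat \<Rightarrow> nat list set" where
  "sample_lists With_Replacement n m = {S. length S = m \<and> set S \<subseteq> {1..n}}"
| "sample_lists Without_Replacement n m = {S. length S = m \<and> set S \<subseteq> {1..n} \<and> distinct S}"

definition draw :: "sampling \<Rightarrow> nat \<Rightarrow> nat \<Rightarrow> nat list pmf" where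
  "draw mode n m = pmf_of_set (sample_lists mode n m)"

definition kappa_q :: "nat \<Rightarrow> (nat \<Rightarrow> real) \<Rightarrow> real \<Rightarrow> nat \<Rightarrow> real" where
  "kappa_q n Ks \<gamma> q = K_hat n Ks q / \<gamma>"

fun kappa_tilde :: "sampling \<Rightarrow> nat \<Rightarrow> (nat \<Rightarrow> real) \<Rightarrow> real \<Rightarrow> nat \<Rightarrow> real" where
  "kappa_tilde With_Replacement n Ks \<gamma> m = kappa_q n Ks \<gamma> 1"
| "kappa_tilde Without_Replacement n Ks \<gamma> m = kappa_q n Ks \<gamma> m"

definition sub_hessian :: "(nat \<Rightarrow> real^'p \<Rightarrow> real) \<Rightarrow> nat list \<Rightarrow> real^'p \<Rightarrow> real^'p^'p" where
  "sub_hessian f S x = (1 / real (length S)) *\<^sub>R (\<Sum>j\<leftarrow>S. hessian (f j) x)"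

definition inexact_direction ::
  "real \<Rightarrow> real \<Rightarrow> real^'p^'p \<Rightarrow> real^'p \<Rightarrow> real^'p \<Rightarrow> bool" where
  "inexact_direction \<theta>1 \<theta>2 H g p \<longleftrightarrow>
     norm (H *v p + g) \<le> \<theta>1 * norm g \<and>
     p \<bullet> g \<le> - (1 - \<theta>2) * (p \<bullet> (H *v p))"

definition armijo :: "(real^'p \<Rightarrow> real) \<Rightarrow> real \<Rightarrow> real^'p \<Rightarrow> real^'p \<Rightarrow> real \<Rightarrow> bool" where
  "armijo F \<beta> x p \<alpha> \<longleftrightarrow> F (x + \<alpha> *\<^sub>R p) \<le> F x + \<alpha> * \<beta> * (p \<bullet> grad F x)"

definition armijo_step ::
  "(real^'p \<Rightarrow> real) \<Rightarrow> real \<Rightarrow> real \<Rightarrow> real^'p \<Rightarrow> real^'p \<Rightarrow> real \<Rightarrow> bool" where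
  "armijo_step F \<beta> \<alpha>hat x p \<alpha> \<longleftrightarrow>
     \<alpha> \<le> \<alpha>hat \<and> armijo F \<beta> x p \<alpha> \<and> (\<forall>a. a \<le> \<alpha>hat \<and> armijo F \<beta> x p a \<longrightarrow> a \<le> \<alpha>)"

(* One iteration from x to x' on the sample S. It is a relation, not a function:
   the direction is any vector that meets the two inexactness conditions. *)
definition newton_iteration ::
  "nat \<Rightarrow> (nat \<Rightarrow> real^'p \<Rightarrow> real) \<Rightarrow> real \<Rightarrow> real \<Rightarrow> real \<Rightarrow> real \<Rightarrow>
   nat list \<Rightarrow> real^'p \<Rightarrow> real \<Rightarrow> real^'p \<Rightarrow> bool" where
  "newton_iteration n f \<theta>1 \<theta>2 \<beta> \<alpha>hat S x \<alpha> x' \<longleftrightarrow>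
     (\<exists>p. inexact_direction \<theta>1 \<theta>2 (sub_hessian f S x) (grad (average n f) x) p \<and>
          armijo_step (average n f) \<beta> \<alpha>hat x p \<alpha> \<and>
          x' = x + \<alpha> *\<^sub>R p)"

definition rate :: "real \<Rightarrow> real \<Rightarrow> real \<Rightarrow> real \<Rightarrow> real \<Rightarrow> real \<Rightarrow> real" where
  "rate \<theta>1 \<theta>2 \<epsilon> \<beta> \<kappa> \<alpha> =
     (if \<theta>1 \<le> sqrt ((1 - \<epsilon>) / (4 * \<kappa>)) then \<alpha> * \<beta> / \<kappa>
      else 2 * (1 - \<theta>2) * (1 - \<theta>1)\<^sup>2 * (1 - \<epsilon>) * \<alpha> * \<beta> / \<kappa>\<^sup>2)"

end

theory Submission
  imports Defs
begin

text \<open>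
  The probabilistic part is a Chernoff bound for the least eigenvalue of a sampled sum, obtained
  without matrix exponentials or the Golden-Thompson inequality. For a self-adjoint \<open>A\<close> with
  eigenvalues \<open>a\<^sub>1, \<dots>, a\<^sub>p\<close> let \<open>\<Phi> A = \<Sum>i. exp (- a\<^sub>i)\<close>. If \<open>0 \<preceq> X \<preceq> R\<close>, then
  \<open>\<Phi> (A + X) \<le> tr (exp (- A) (1 - (1 - R / 2) X))\<close>; this follows from one scalar inequality in two
  eigenvalues, summed over eigenbases of \<open>A\<close> and \<open>A + X\<close>. Hence one draw from a family with mean
  \<open>\<succeq> \<gamma>\<close> decreases the expectation of \<open>\<Phi>\<close> by the factor \<open>exp (- (1 - R / 2) \<gamma>)\<close>. Without replacement
  the same factor is available, because \<open>\<Phi>\<close> is midpoint convex and therefore on average no larger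
  on a fresh index than on a repeated one. Markov's inequality for \<open>X\<close> scaled by \<open>\<epsilon> / R\<close> finishes.

  On the event \<open>(1 - \<epsilon>) \<gamma> \<preceq> H\<close>, a second-order Taylor expansion bounds the Armijo step from below, and
  the inexactness conditions bound \<open>- p \<bullet> \<nabla>F\<close> from below by a multiple of \<open>\<parallel>\<nabla>F\<parallel>\<^sup>2\<close>, which strong convexity
  compares with \<open>F x - F x*\<close>.
\<close>

subsection \<open>Eigenbases of self-adjoint operators\<close>

definition self_adjoint :: "('a::euclidean_space \<Rightarrow> 'a) \<Rightarrow> bool" where
  "self_adjoint f \<longleftrightarrow> linear f \<and> (\<forall>x y. f x \<bullet> y = x \<bullet> f y)"

lemma self_adjoint_linear: "self_adjoint f \<Longrightarrow> linear f"
  and self_adjoint_inner: "self_adjoint f \<Longrightarrow> f x \<bullet> y = x \<bullet> f y"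
  by (simp_all add: self_adjoint_def)

lemma self_adjoint_zero: "self_adjoint (\<lambda>x. 0)"
  by (simp add: self_adjoint_def linear_zero)

lemma self_adjoint_add:
  "self_adjoint f \<Longrightarrow> self_adjoint g \<Longrightarrow> self_adjoint (\<lambda>x. f x + g x)"
  by (simp add: self_adjoint_def linear_compose_add inner_add_left inner_add_right)

lemma self_adjoint_diff:
  "self_adjoint f \<Longrightarrow> self_adjoint g \<Longrightarrow> self_adjoint (\<lambda>x. f x - g x)"
  by (simp add: self_adjoint_def linear_compose_sub inner_diff_left inner_diff_right)

lemma self_adjoint_scale: "self_adjoint f \<Longrightarrow> self_adjoint (\<lambda>x. c *\<^sub>R f x)"
  by (simp add: self_adjoint_def linear_compose_scale_right)

text \<open>For small positive \<open>t\<close> the linear side would win unless \<open>a\<close>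
  vanishes. This acts as the first-order condition at a maximum of a quadratic form.\<close>

lemma linear_leq_square_imp_zero:
  fixes a C :: real
  assumes "\<And>t. t * a \<le> t\<^sup>2 * C" "0 \<le> a"
  shows "a = 0"
proof (rule ccontr)
  assume "a \<noteq> 0"
  with assms have "0 < a" by simp
  define t where "t = a / (2 * (\<bar>C\<bar> + 1))"
  have "0 < t" using \<open>0 < a\<close> by (simp add: t_def)
  have "t * a \<le> t * (t * C)" using assms(1)[of t] by (simp add: power2_eq_square mult.assoc)
  hence "a \<le> t * C" using \<open>0 < t\<close> by simp
  also have "\<dots> \<le> t * (\<bar>C\<bar> + 1)" using \<open>0 < t\<close> by (intro mult_left_mono) auto
  also have "\<dots> = a / 2" by (simp add: t_def divide_simps)
  finally show False using \<open>0 < a\<close> by simp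
qed

text \<open>A maximizer \<open>u\<close> of the quadratic form on the unit sphere of
  \<open>S\<close> is an eigenvector: the residual \<open>r\<close> lies in \<open>S\<close> and is
  orthogonal to \<open>u\<close>, so moving along it would raise the form to first order unless it
  is 0.\<close>

lemma self_adjoint_eigenvector_in_subspace:
  fixes f :: "'a::euclidean_space \<Rightarrow> 'a"
  assumes f: "self_adjoint f" and S: "subspace S" "\<And>x. x \<in> S \<Longrightarrow> f x \<in> S" and "S \<noteq> {0}"
  obtains u where "u \<in> S" "norm u = 1" "f u = (u \<bullet> f u) *\<^sub>R u"
proof -
  interpret linear f using f by (rule self_adjoint_linear)
  obtain z where z: "z \<in> S" "z \<noteq> 0"
    using \<open>S \<noteq> {0}\<close> subspace_0[OF S(1)] by blast
  have "z /\<^sub>R norm z \<in> S \<inter> sphere 0 1"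
    using z S(1) by (simp add: subspace_scale)
  hence "S \<inter> sphere 0 1 \<noteq> {}" by blast
  moreover have "compact (S \<inter> sphere 0 1)"
    using closed_subspace[OF S(1)] by (simp add: closed_Int_compact)
  moreover have "continuous_on (S \<inter> sphere 0 1) (\<lambda>x. x \<bullet> f x)"
    by (intro continuous_intros linear_continuous_on)
      (use linear_axioms linear_conv_bounded_linear in blast)
  ultimately obtain u where u: "u \<in> S \<inter> sphere 0 1"
    and max: "\<And>y. y \<in> S \<inter> sphere 0 1 \<Longrightarrow> y \<bullet> f y \<le> u \<bullet> f u"
    using continuous_attains_sup[of "S \<inter> sphere 0 1" "\<lambda>x. x \<bullet> f x"] by metis
  define l where "l = u \<bullet> f u"
  define r where "r = f u - l *\<^sub>R u"
  have nu: "u \<bullet> u = 1" using u by (simp add: dot_square_norm)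
  have rS: "r \<in> S" using u S by (simp add: r_def subspace_diff subspace_scale)
  have le: "y \<bullet> f y \<le> l * (y \<bullet> y)" if "y \<in> S" for y
  proof (cases "y = 0")
    case False
    have "y /\<^sub>R norm y \<in> S \<inter> sphere 0 1" using that False S(1) by (simp add: subspace_scale)
    from max[OF this] show ?thesis using False
      by (simp add: l_def scale dot_square_norm divide_simps power2_eq_square mult.commute)
  qed (simp add: zero)
  have ur: "r \<bullet> u = 0" by (simp add: r_def inner_diff_left l_def nu inner_commute[of "f u"])
  have fu: "f u = r + l *\<^sub>R u" by (simp add: r_def)
  have "t * (2 * (r \<bullet> r)) \<le> t\<^sup>2 * (l * (r \<bullet> r) - r \<bullet> f r)" for t
  proof -
    have "u + t *\<^sub>R r \<in> S" using u rS S(1) by (simp add: subspace_add subspace_scale)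
    from le[OF this] have "(u + t *\<^sub>R r) \<bullet> (f u + t *\<^sub>R f r) \<le> l * (1 + t\<^sup>2 * (r \<bullet> r))"
      using nu ur by (simp add: add scale inner_add_left inner_add_right inner_commute
          algebra_simps power2_eq_square)
    moreover have "u \<bullet> f r = r \<bullet> r"
      using ur by (simp add: self_adjoint_inner[OF f, symmetric] fu inner_add_left inner_add_right inner_commute)
    moreover have "r \<bullet> f u = r \<bullet> r" using ur by (simp add: fu inner_add_right)
    moreover have "u \<bullet> f u = l" by (simp add: l_def)
    ultimately show ?thesis
      by (simp add: inner_add_left inner_add_right algebra_simps power2_eq_square)
  qed
  hence "2 * (r \<bullet> r) = 0" by (rule linear_leq_square_imp_zero) simp
  hence "f u = (u \<bullet> f u) *\<^sub>R u" by (simp add: r_def l_def)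
  with u show ?thesis by (intro that) auto
qed

text \<open>Eigenvalues are read off as \<open>b \<bullet> f b\<close>; indexing them by basis
  vectors keeps multiplicities.\<close>

definition eigenbasis :: "('a::euclidean_space \<Rightarrow> 'a) \<Rightarrow> 'a set \<Rightarrow> bool" where
  "eigenbasis f B \<longleftrightarrow> finite B \<and> pairwise orthogonal B \<and> (\<forall>b\<in>B. norm b = 1) \<and> span B = UNIV \<and>
     (\<forall>b\<in>B. f b = (b \<bullet> f b) *\<^sub>R b)"

lemma orthonormal_independent:
  fixes B :: "'a::euclidean_space set"
  assumes "pairwise orthogonal B" "\<forall>b\<in>B. norm b = 1"
  shows "independent B"
  using assms by (intro pairwise_orthogonal_independent) auto

text \<open>Orthonormal eigenvectors are collected one at a time: the orthogonal complement of those
  found is invariant under \<open>f\<close>, and nonzero while there are fewer than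
  \<open>DIM('a)\<close>.\<close>

theorem spectral_theorem:
  fixes f :: "'a::euclidean_space \<Rightarrow> 'a"
  assumes f: "self_adjoint f"
  shows "\<exists>B. eigenbasis f B"
proof -
  interpret linear f using f by (rule self_adjoint_linear)
  have "k \<le> DIM('a) \<Longrightarrow> \<exists>B. card B = k \<and> finite B \<and> pairwise orthogonal B \<and>
     (\<forall>b\<in>B. norm b = 1) \<and> (\<forall>b\<in>B. f b = (b \<bullet> f b) *\<^sub>R b)" for k
  proof (induction k)
    case 0
    show ?case by (rule exI[of _ "{}"]) simp
  next
    case (Suc k)
    then obtain B where B: "card B = k" "finite B" "pairwise orthogonal B" "\<forall>b\<in>B. norm b = 1"
      "\<forall>b\<in>B. f b = (b \<bullet> f b) *\<^sub>R b" by auto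
    define S where "S = {x. \<forall>b\<in>B. b \<bullet> x = 0}"
    have "dim B < DIM('a)" using dim_le_card'[OF B(2)] B(1) Suc.prems by linarith
    then obtain z where "z \<noteq> 0" "\<And>x. x \<in> span B \<Longrightarrow> orthogonal z x"
      using orthogonal_to_subspace_exists by blast
    hence "z \<in> S" by (auto simp: S_def orthogonal_def inner_commute span_base)
    with \<open>z \<noteq> 0\<close> have "S \<noteq> {0}" by auto
    moreover have "subspace S" by (auto simp: S_def subspace_def inner_add_right)
    moreover have "f x \<in> S" if "x \<in> S" for x
      unfolding S_def
    proof (intro CollectI ballI)
      fix b assume b: "b \<in> B"
      have "b \<bullet> f x = ((b \<bullet> f b) *\<^sub>R b) \<bullet> x"
        using B(5) b by (metis self_adjoint_inner[OF f])
      also have "\<dots> = 0" using that b by (simp add: S_def)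
      finally show "b \<bullet> f x = 0" .
    qed
    ultimately obtain u where u: "u \<in> S" "norm u = 1" "f u = (u \<bullet> f u) *\<^sub>R u"
      using self_adjoint_eigenvector_in_subspace[OF f] by metis
    have "u \<notin> B" using u by (auto simp: S_def)
    have "pairwise orthogonal (insert u B)"
      using B(3) u(1) by (auto simp: pairwise_insert S_def orthogonal_def inner_commute)
    thus ?case using B u \<open>u \<notin> B\<close> by (intro exI[of _ "insert u B"]) auto
  qed
  from this[of "DIM('a)"] obtain B where B: "card B = DIM('a)" "finite B" "pairwise orthogonal B"
      "\<forall>b\<in>B. norm b = 1" "\<forall>b\<in>B. f b = (b \<bullet> f b) *\<^sub>R b" by auto
  have "independent B" using B orthonormal_independent by blast
  hence "UNIV \<subseteq> span B" using B(1) by (intro card_ge_dim_independent) auto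
  thus ?thesis using B by (auto simp: eigenbasis_def)
qed

lemma eigenbasis_card:
  assumes "eigenbasis (f :: 'a::euclidean_space \<Rightarrow> 'a) B"
  shows "card B = DIM('a)"
  using assms orthonormal_independent[of B]
  by (metis dim_UNIV dim_eq_card_independent dim_span eigenbasis_def)

lemma eigenbasis_parseval:
  assumes "eigenbasis f B"
  shows "x \<bullet> y = (\<Sum>b\<in>B. (x \<bullet> b) * (y \<bullet> b))"
proof -
  have "(\<Sum>b\<in>B. (y \<bullet> b) *\<^sub>R b) = y"
    using assms by (intro orthonormal_basis_expand) (auto simp: eigenbasis_def)
  hence "x \<bullet> y = x \<bullet> (\<Sum>b\<in>B. (y \<bullet> b) *\<^sub>R b)" by simp
  also have "\<dots> = (\<Sum>b\<in>B. (x \<bullet> b) * (y \<bullet> b))"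
    by (simp add: inner_sum_right mult.commute)
  finally show ?thesis .
qed

lemma eigenbasis_quadratic_form:
  assumes "self_adjoint f" "eigenbasis f B"
  shows "x \<bullet> f x = (\<Sum>b\<in>B. (b \<bullet> f b) * (x \<bullet> b)\<^sup>2)"
proof -
  have "f x \<bullet> b = (b \<bullet> f b) * (x \<bullet> b)" if "b \<in> B" for b
  proof -
    have "f b = (b \<bullet> f b) *\<^sub>R b" using assms(2) that by (simp add: eigenbasis_def)
    hence "f x \<bullet> b = x \<bullet> ((b \<bullet> f b) *\<^sub>R b)"
      using assms(1) by (metis self_adjoint_inner)
    thus ?thesis by simp
  qed
  thus ?thesis
    by (simp add: eigenbasis_parseval[OF assms(2), of x "f x"] power2_eq_square algebra_simps)
qed

text \<open>The weights \<open>1/3\<close> and \<open>1/6\<close> add up to \<open>1/2\<close> and make the third-order terms in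
  \<open>b - a\<close> cancel; with any other split of \<open>1/2\<close> the inequality fails on one side of \<open>b = a\<close>.\<close>
lemma exp_minus_le_quadratic:
  fixes a b :: real
  shows "exp (- b) \<le> exp (- a) * (1 - (b - a) + (b - a)\<^sup>2 / 3) + exp (- b) * ((b - a)\<^sup>2 / 6)"
proof -
  \<comment> \<open>The claim divided by \<open>exp (- b)\<close>, with \<open>t = b - a\<close>.
    The derivative of \<open>k\<close> has the sign of \<open>t\<close>, so the minimum is
    \<open>k 0 = 0\<close>.\<close>
  define k where "k t = exp t * (1 - t + t\<^sup>2 / 3) - 1 + t\<^sup>2 / 6" for t :: real
  have deriv: "(k has_real_derivative (t / 3) * (exp t * (t - 1) + 1)) (at t)" for t
    unfolding k_def
    by (auto intro!: derivative_eq_intros simp: field_simps power2_eq_square)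
  have pos: "0 \<le> exp t * (t - 1) + 1" for t :: real
  proof -
    have "exp t * (1 - t) \<le> exp t * exp (- t)"
      using exp_ge_add_one_self[of "- t"] by (intro mult_left_mono) auto
    also have "\<dots> = 1" by (simp add: exp_minus)
    finally show ?thesis by (simp add: algebra_simps)
  qed
  have k: "0 \<le> k t" for t
  proof (cases "0 \<le> t")
    case True
    have "k 0 \<le> k t"
      using True pos deriv
      by (intro DERIV_nonneg_imp_nondecreasing[of 0 t k]) (auto intro!: exI mult_nonneg_nonneg)
    thus ?thesis by (simp add: k_def)
  next
    case False
    have "k 0 \<le> k t"
      using False pos deriv
      by (intro DERIV_nonpos_imp_nonincreasing[of t 0 k]) (auto intro!: exI mult_nonpos_nonneg)
    thus ?thesis by (simp add: k_def)
  qed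
  define d where "d = b - a"
  have "0 \<le> exp (- b) * k d" using k by simp
  also have "\<dots> = exp (- b) * exp d * (1 - d + d\<^sup>2 / 3) - exp (- b) + exp (- b) * (d\<^sup>2 / 6)"
    by (simp add: k_def algebra_simps)
  also have "exp (- b) * exp d = exp (- a)" by (simp add: d_def flip: exp_add)
  finally show ?thesis unfolding d_def by simp
qed

text \<open>The squared inner products \<open>(u \<bullet> v)\<^sup>2\<close> form a doubly stochastic matrix whose moments in
  the eigenvalue differences are quadratic expressions in \<open>g\<close>. Scalar inequalities in two
  eigenvalues, weighted with it, become trace inequalities.\<close>
locale perturbed_eigenbases =
  fixes f g :: "'a::euclidean_space \<Rightarrow> 'a" and U V :: "'a set"
  assumes f: "self_adjoint f" and g: "self_adjoint g"
    and U: "eigenbasis f U" and V: "eigenbasis (\<lambda>x. f x + g x) V"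
begin

abbreviation "lamU u \<equiv> u \<bullet> f u"
abbreviation "lamV v \<equiv> v \<bullet> (f v + g v)"

text \<open>\<open>g\<close> is the difference of the two operators; letting \<open>f + g\<close>
  act on \<open>v\<close> and \<open>f\<close> on \<open>u\<close> leaves an eigenvalue difference
  times the overlap.\<close>

lemma inner_perturbation:
  assumes "u \<in> U" "v \<in> V"
  shows "g u \<bullet> v = (lamV v - lamU u) * (u \<bullet> v)"
    and "g v \<bullet> u = (lamV v - lamU u) * (u \<bullet> v)"
proof -
  have fu: "f u = lamU u *\<^sub>R u" using U assms by (simp add: eigenbasis_def)
  have fv: "f v + g v = lamV v *\<^sub>R v" using V assms unfolding eigenbasis_def by blast
  have "g u \<bullet> v = u \<bullet> (f v + g v) - f u \<bullet> v"
    by (simp add: self_adjoint_inner[OF f] self_adjoint_inner[OF g] inner_add_right)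
  also have "\<dots> = (lamV v - lamU u) * (u \<bullet> v)"
    by (subst fu, subst fv) (simp add: algebra_simps)
  finally show "g u \<bullet> v = (lamV v - lamU u) * (u \<bullet> v)" .
  thus "g v \<bullet> u = (lamV v - lamU u) * (u \<bullet> v)"
    by (metis inner_commute self_adjoint_inner[OF g])
qed

lemma row_sums:
  assumes "u \<in> U"
  shows "(\<Sum>v\<in>V. (u \<bullet> v)\<^sup>2) = 1"
    and "(\<Sum>v\<in>V. (lamV v - lamU u) * (u \<bullet> v)\<^sup>2) = u \<bullet> g u"
    and "(\<Sum>v\<in>V. (lamV v - lamU u)\<^sup>2 * (u \<bullet> v)\<^sup>2) = g u \<bullet> g u"
proof -
  have "u \<bullet> u = 1" using U assms by (simp add: eigenbasis_def dot_square_norm)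
  thus "(\<Sum>v\<in>V. (u \<bullet> v)\<^sup>2) = 1"
    by (simp add: eigenbasis_parseval[OF V, of u u] power2_eq_square)
  show "(\<Sum>v\<in>V. (lamV v - lamU u) * (u \<bullet> v)\<^sup>2) = u \<bullet> g u"
    unfolding eigenbasis_parseval[OF V, of u "g u"]
    by (intro sum.cong refl) (simp add: inner_perturbation assms power2_eq_square)
  show "(\<Sum>v\<in>V. (lamV v - lamU u)\<^sup>2 * (u \<bullet> v)\<^sup>2) = g u \<bullet> g u"
    unfolding eigenbasis_parseval[OF V, of "g u" "g u"]
    by (intro sum.cong refl) (simp add: inner_perturbation assms power2_eq_square)
qed

lemma column_sums:
  assumes "v \<in> V"
  shows "(\<Sum>u\<in>U. (u \<bullet> v)\<^sup>2) = 1"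
    and "(\<Sum>u\<in>U. (lamV v - lamU u) * (u \<bullet> v)\<^sup>2) = v \<bullet> g v"
    and "(\<Sum>u\<in>U. (lamV v - lamU u)\<^sup>2 * (u \<bullet> v)\<^sup>2) = g v \<bullet> g v"
proof -
  have "v \<bullet> v = 1" using V assms by (simp add: eigenbasis_def dot_square_norm)
  thus "(\<Sum>u\<in>U. (u \<bullet> v)\<^sup>2) = 1"
    by (simp add: eigenbasis_parseval[OF U, of v v] power2_eq_square inner_commute)
  show "(\<Sum>u\<in>U. (lamV v - lamU u) * (u \<bullet> v)\<^sup>2) = v \<bullet> g v"
    unfolding eigenbasis_parseval[OF U, of v "g v"]
    by (intro sum.cong refl)
      (simp add: inner_perturbation assms power2_eq_square inner_commute[of v])
  show "(\<Sum>u\<in>U. (lamV v - lamU u)\<^sup>2 * (u \<bullet> v)\<^sup>2) = g v \<bullet> g v"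
    unfolding eigenbasis_parseval[OF U, of "g v" "g v"]
    by (intro sum.cong refl) (simp add: inner_perturbation assms power2_eq_square)
qed

lemma exp_sum_as_double_sum:
  "(\<Sum>v\<in>V. exp (- lamV v)) = (\<Sum>u\<in>U. \<Sum>v\<in>V. exp (- lamV v) * (u \<bullet> v)\<^sup>2)"
  by (subst sum.swap) (simp add: column_sums flip: sum_distrib_left)

text \<open>Klein's inequality for \<open>exp (- x)\<close>: the tangent bound at
  \<open>lamU u\<close> holds for each pair of eigenvalues and is summed with the weights
  \<open>(u \<bullet> v)\<^sup>2\<close>.\<close>

lemma exp_sum_ge:
  "(\<Sum>u\<in>U. exp (- lamU u) * (1 - u \<bullet> g u)) \<le> (\<Sum>v\<in>V. exp (- lamV v))"
proof -
  have "(\<Sum>u\<in>U. exp (- lamU u) * (1 - u \<bullet> g u)) =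
      (\<Sum>u\<in>U. \<Sum>v\<in>V. exp (- lamU u) * (1 - (lamV v - lamU u)) * (u \<bullet> v)\<^sup>2)"
  proof (intro sum.cong refl)
    fix u assume u: "u \<in> U"
    show "exp (- lamU u) * (1 - u \<bullet> g u) =
        (\<Sum>v\<in>V. exp (- lamU u) * (1 - (lamV v - lamU u)) * (u \<bullet> v)\<^sup>2)"
      by (subst (1) row_sums(2)[OF u, symmetric], subst (1) row_sums(1)[OF u, symmetric])
        (simp add: sum_subtractf[symmetric] sum_distrib_left left_diff_distrib mult.assoc
          del: inner_add_right)
  qed
  also have "\<dots> \<le> (\<Sum>u\<in>U. \<Sum>v\<in>V. exp (- lamV v) * (u \<bullet> v)\<^sup>2)"
  proof (intro sum_mono mult_right_mono)
    fix u v
    have "exp (- lamU u) * (1 - (lamV v - lamU u)) \<le> exp (- lamU u) * exp (- (lamV v - lamU u))"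
      using exp_ge_add_one_self[of "- (lamV v - lamU u)"]
      by (intro mult_left_mono) (simp_all only: uminus_add_conv_diff diff_conv_add_uminus exp_ge_zero)
    also have "\<dots> = exp (- lamV v)" by (simp flip: exp_add)
    finally show "exp (- lamU u) * (1 - (lamV v - lamU u)) \<le> exp (- lamV v)" .
  qed simp
  finally show ?thesis by (simp only: exp_sum_as_double_sum)
qed

text \<open>Square terms carrying \<open>exp (- lamU u)\<close> are summed over \<open>v\<close>,
  those carrying \<open>exp (- lamV v)\<close> over \<open>u\<close>. The hypothesis on
  \<open>R\<close> turns both into first-order terms, with total loss
  \<open>R / 3 + R / 6 = R / 2\<close>.\<close>

lemma exp_sum_le:
  assumes R: "0 \<le> R" "\<And>x. g x \<bullet> g x \<le> R * (x \<bullet> g x)"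
  shows "(\<Sum>v\<in>V. exp (- lamV v)) \<le> (\<Sum>u\<in>U. exp (- lamU u) * (1 - (1 - R / 2) * (u \<bullet> g u)))"
proof -
  define d where "d u v = lamV v - lamU u" for u v
  define q where "q u v = (u \<bullet> v)\<^sup>2" for u v :: 'a
  have row: "(\<Sum>v\<in>V. q u v) = 1" "(\<Sum>v\<in>V. d u v * q u v) = u \<bullet> g u"
    "(\<Sum>v\<in>V. (d u v)\<^sup>2 * q u v) = g u \<bullet> g u" if "u \<in> U" for u
    using row_sums[OF that] by (simp_all only: d_def q_def)
  have col: "(\<Sum>u\<in>U. d u v * q u v) = v \<bullet> g v"
    "(\<Sum>u\<in>U. (d u v)\<^sup>2 * q u v) = g v \<bullet> g v" if "v \<in> V" for v
    using column_sums[OF that] by (simp_all only: d_def q_def)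
  have "(\<Sum>v\<in>V. exp (- lamV v)) = (\<Sum>u\<in>U. \<Sum>v\<in>V. exp (- lamV v) * q u v)"
    by (simp only: exp_sum_as_double_sum q_def)
  also have "\<dots> \<le> (\<Sum>u\<in>U. \<Sum>v\<in>V. (exp (- lamU u) * (1 - d u v + (d u v)\<^sup>2 / 3)
       + exp (- lamV v) * ((d u v)\<^sup>2 / 6)) * q u v)"
    unfolding d_def
    by (intro sum_mono mult_right_mono exp_minus_le_quadratic) (simp add: q_def)
  also have "\<dots> = (\<Sum>u\<in>U. exp (- lamU u) *
          ((\<Sum>v\<in>V. q u v) - (\<Sum>v\<in>V. d u v * q u v) + (\<Sum>v\<in>V. (d u v)\<^sup>2 * q u v) / 3))
       + (\<Sum>u\<in>U. \<Sum>v\<in>V. exp (- lamV v) * ((d u v)\<^sup>2 * q u v) / 6)"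
    by (simp add: sum_distrib_left sum_subtractf[symmetric] sum.distrib[symmetric] sum_divide_distrib
        algebra_simps)
  also have "(\<Sum>u\<in>U. \<Sum>v\<in>V. exp (- lamV v) * ((d u v)\<^sup>2 * q u v) / 6)
      = (\<Sum>v\<in>V. exp (- lamV v) * (\<Sum>u\<in>U. (d u v)\<^sup>2 * q u v) / 6)"
    by (subst sum.swap) (simp only: sum_distrib_left sum_divide_distrib)
  also have "\<dots> = (\<Sum>v\<in>V. exp (- lamV v) * (g v \<bullet> g v) / 6)"
    by (simp add: col)
  also have "\<dots> \<le> (\<Sum>v\<in>V. exp (- lamV v) * (R * (v \<bullet> g v)) / 6)"
    by (intro sum_mono divide_right_mono mult_left_mono R) auto
  also have "\<dots> = R / 6 * (\<Sum>v\<in>V. \<Sum>u\<in>U. exp (- lamV v) * (d u v * q u v))"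
    by (simp add: col flip: sum_distrib_left) (simp add: sum_distrib_left algebra_simps)
  \<comment> \<open>Since \<open>exp (- x)\<close> decreases, replacing \<open>lamV v\<close> by
    \<open>lamU u\<close> never lowers the term, whichever sign \<open>d u v\<close> has. All sums
    are then back in the eigenbasis of \<open>f\<close>.\<close>
  also have "\<dots> \<le> R / 6 * (\<Sum>v\<in>V. \<Sum>u\<in>U. exp (- lamU u) * (d u v * q u v))"
  proof (intro mult_left_mono sum_mono)
    fix u v
    have "exp (- lamV v) * d u v \<le> exp (- lamU u) * d u v"
    proof (cases "0 \<le> d u v")
      case True
      thus ?thesis by (intro mult_right_mono) (auto simp: d_def)
    next
      case False
      thus ?thesis by (intro mult_right_mono_neg) (auto simp: d_def)
    qed
    hence "exp (- lamV v) * d u v * q u v \<le> exp (- lamU u) * d u v * q u v"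
      by (rule mult_right_mono) (simp add: q_def)
    thus "exp (- lamV v) * (d u v * q u v) \<le> exp (- lamU u) * (d u v * q u v)"
      by (simp only: mult.assoc)
  qed (use R in auto)
  also have "(\<Sum>v\<in>V. \<Sum>u\<in>U. exp (- lamU u) * (d u v * q u v))
      = (\<Sum>u\<in>U. exp (- lamU u) * (\<Sum>v\<in>V. d u v * q u v))"
    by (subst sum.swap) (simp only: sum_distrib_left)
  also have "(\<Sum>u\<in>U. exp (- lamU u) *
          ((\<Sum>v\<in>V. q u v) - (\<Sum>v\<in>V. d u v * q u v) + (\<Sum>v\<in>V. (d u v)\<^sup>2 * q u v) / 3)) +
       R / 6 * (\<Sum>u\<in>U. exp (- lamU u) * (\<Sum>v\<in>V. d u v * q u v))
     = (\<Sum>u\<in>U. exp (- lamU u) * (1 - (u \<bullet> g u) + (g u \<bullet> g u) / 3 + R / 6 * (u \<bullet> g u)))"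
    unfolding sum_distrib_left[of "R / 6"] sum.distrib[symmetric]
  proof (intro sum.cong refl)
    fix u assume u: "u \<in> U"
    show "exp (- lamU u) *
          ((\<Sum>v\<in>V. q u v) - (\<Sum>v\<in>V. d u v * q u v) + (\<Sum>v\<in>V. (d u v)\<^sup>2 * q u v) / 3) +
       R / 6 * (exp (- lamU u) * (\<Sum>v\<in>V. d u v * q u v))
     = exp (- lamU u) * (1 - (u \<bullet> g u) + (g u \<bullet> g u) / 3 + R / 6 * (u \<bullet> g u))"
      by (simp only: row[OF u]) (simp add: algebra_simps)
  qed
  also have "\<dots> \<le> (\<Sum>u\<in>U. exp (- lamU u) * (1 - (1 - R / 2) * (u \<bullet> g u)))"
  proof (intro sum_mono mult_left_mono)
    fix u
    show "1 - (u \<bullet> g u) + (g u \<bullet> g u) / 3 + R / 6 * (u \<bullet> g u) \<le> 1 - (1 - R / 2) * (u \<bullet> g u)"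
      using R(2)[of u] by (simp add: algebra_simps)
  qed simp
  finally show ?thesis by simp
qed

end

subsection \<open>The trace potential\<close>

text \<open>Every fact below holds for an arbitrary eigenbasis, so it is never needed that the value
  does not depend on the choice.\<close>
definition trace_exp_neg :: "('a::euclidean_space \<Rightarrow> 'a) \<Rightarrow> real" where
  "trace_exp_neg f = (\<Sum>b\<in>(SOME B. eigenbasis f B). exp (- (b \<bullet> f b)))"

lemma trace_exp_neg_eq:
  assumes "self_adjoint f"
  obtains B where "eigenbasis f B" "trace_exp_neg f = (\<Sum>b\<in>B. exp (- (b \<bullet> f b)))"
  using someI_ex[OF spectral_theorem[OF assms]] that by (simp add: trace_exp_neg_def)

lemma trace_exp_neg_nonneg: "0 \<le> trace_exp_neg f"
  by (simp add: trace_exp_neg_def sum_nonneg)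

lemma trace_exp_neg_zero: "trace_exp_neg (\<lambda>x::'a::euclidean_space. 0 :: 'a) = DIM('a)"
proof -
  obtain B where B: "eigenbasis (\<lambda>x::'a. 0 :: 'a) B"
    "trace_exp_neg (\<lambda>x::'a. 0 :: 'a) = (\<Sum>b\<in>B. exp (- (b \<bullet> 0)))"
    by (rule trace_exp_neg_eq[OF self_adjoint_zero])
  thus ?thesis by (simp add: eigenbasis_card[OF B(1)])
qed

text \<open>Were all eigenvalues above \<open>t\<close>, the form would be at least
  \<open>t * (v \<bullet> v)\<close>. So some eigenvalue is at most \<open>t\<close>, and its term
  alone suffices.\<close>

lemma exp_le_trace_exp_neg:
  assumes f: "self_adjoint f" and v: "v \<bullet> f v < t * (v \<bullet> v)"
  shows "exp (- t) \<le> trace_exp_neg f"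
proof -
  obtain B where B: "eigenbasis f B" and eq: "trace_exp_neg f = (\<Sum>b\<in>B. exp (- (b \<bullet> f b)))"
    by (rule trace_exp_neg_eq[OF f])
  have "\<exists>b\<in>B. b \<bullet> f b \<le> t"
  proof (rule ccontr)
    assume "\<not> ?thesis"
    hence "(\<Sum>b\<in>B. t * (v \<bullet> b)\<^sup>2) \<le> (\<Sum>b\<in>B. (b \<bullet> f b) * (v \<bullet> b)\<^sup>2)"
      by (intro sum_mono mult_right_mono) auto
    also have "\<dots> = v \<bullet> f v" by (rule eigenbasis_quadratic_form[OF f B, symmetric])
    also have "(\<Sum>b\<in>B. t * (v \<bullet> b)\<^sup>2) = t * (v \<bullet> v)"
      by (simp add: eigenbasis_parseval[OF B, of v v] power2_eq_square sum_distrib_left)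
    finally show False using v by simp
  qed
  then obtain b where b: "b \<in> B" "b \<bullet> f b \<le> t" by blast
  have "exp (- t) \<le> exp (- (b \<bullet> f b))" using b by simp
  also have "\<dots> \<le> trace_exp_neg f"
    unfolding eq using B b(1) by (intro member_le_sum) (auto simp: eigenbasis_def)
  finally show ?thesis .
qed

text \<open>The tangent bound at \<open>h\<close> is taken in the directions \<open>k\<close> and
  \<open>- k\<close>; the first-order terms cancel.\<close>

lemma trace_exp_neg_midpoint_convex:
  assumes h: "self_adjoint h" and k: "self_adjoint k"
  shows "2 * trace_exp_neg h \<le> trace_exp_neg (\<lambda>x. h x + k x) + trace_exp_neg (\<lambda>x. h x - k x)"
proof -
  obtain U where U: "eigenbasis h U" and eqU: "trace_exp_neg h = (\<Sum>u\<in>U. exp (- (u \<bullet> h u)))"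
    by (rule trace_exp_neg_eq[OF h])
  have lower: "(\<Sum>u\<in>U. exp (- (u \<bullet> h u)) * (1 - u \<bullet> g u)) \<le> trace_exp_neg (\<lambda>x. h x + g x)"
    if g: "self_adjoint g" for g
  proof -
    obtain V where V: "eigenbasis (\<lambda>x. h x + g x) V"
      and eqV: "trace_exp_neg (\<lambda>x. h x + g x) = (\<Sum>v\<in>V. exp (- (v \<bullet> (h v + g v))))"
      by (rule trace_exp_neg_eq[OF self_adjoint_add[OF h g]])
    interpret perturbed_eigenbases h g U V by unfold_locales (fact h g U V)+
    show ?thesis unfolding eqV by (rule exp_sum_ge)
  qed
  have "2 * trace_exp_neg h = (\<Sum>u\<in>U. exp (- (u \<bullet> h u)) * (1 - u \<bullet> k u))
      + (\<Sum>u\<in>U. exp (- (u \<bullet> h u)) * (1 - u \<bullet> (- k u)))"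
    by (simp add: eqU sum_distrib_left algebra_simps flip: sum.distrib)
  also have "\<dots> \<le> trace_exp_neg (\<lambda>x. h x + k x) + trace_exp_neg (\<lambda>x. h x + - k x)"
    using self_adjoint_scale[OF k, of "-1"] by (intro add_mono lower k) simp
  finally show ?thesis by simp
qed

text \<open>In a fixed eigenbasis of \<open>f\<close> the upper bound is affine in
  \<open>X j\<close>, so only the sum of the family enters; \<open>1 - z \<le> exp (- z)\<close>
  then gives the factor. \<open>R \<le> 2\<close> keeps \<open>1 - R / 2\<close>
  nonnegative.\<close>

lemma sum_trace_exp_neg_add_le:
  fixes f :: "'a::euclidean_space \<Rightarrow> 'a" and X :: "'i \<Rightarrow> 'a \<Rightarrow> 'a"
  assumes f: "self_adjoint f"
    and X: "\<And>j. j \<in> J \<Longrightarrow> self_adjoint (X j)"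
    and R: "0 \<le> R" "R \<le> 2" "\<And>j v. j \<in> J \<Longrightarrow> X j v \<bullet> X j v \<le> R * (v \<bullet> X j v)"
    and mean: "\<And>v. real (card J) * c * (v \<bullet> v) \<le> (\<Sum>j\<in>J. v \<bullet> X j v)"
  shows "(\<Sum>j\<in>J. trace_exp_neg (\<lambda>v. f v + X j v))
      \<le> real (card J) * exp (- ((1 - R / 2) * c)) * trace_exp_neg f"
proof -
  obtain U where U: "eigenbasis f U" and eqU: "trace_exp_neg f = (\<Sum>u\<in>U. exp (- (u \<bullet> f u)))"
    by (rule trace_exp_neg_eq[OF f])
  have "(\<Sum>j\<in>J. trace_exp_neg (\<lambda>v. f v + X j v))
      \<le> (\<Sum>j\<in>J. \<Sum>u\<in>U. exp (- (u \<bullet> f u)) * (1 - (1 - R / 2) * (u \<bullet> X j u)))"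
  proof (rule sum_mono)
    fix j assume j: "j \<in> J"
    obtain V where V: "eigenbasis (\<lambda>x. f x + X j x) V"
      and eqV: "trace_exp_neg (\<lambda>x. f x + X j x) = (\<Sum>v\<in>V. exp (- (v \<bullet> (f v + X j v))))"
      by (rule trace_exp_neg_eq[OF self_adjoint_add[OF f X[OF j]]])
    interpret perturbed_eigenbases f "X j" U V by unfold_locales (fact f X[OF j] U V)+
    show "trace_exp_neg (\<lambda>v. f v + X j v)
        \<le> (\<Sum>u\<in>U. exp (- (u \<bullet> f u)) * (1 - (1 - R / 2) * (u \<bullet> X j u)))"
      unfolding eqV by (rule exp_sum_le[OF R(1) R(3)[OF j]])
  qed
  also have "\<dots> = (\<Sum>u\<in>U. exp (- (u \<bullet> f u))
      * (real (card J) - (1 - R / 2) * (\<Sum>j\<in>J. u \<bullet> X j u)))"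
    by (subst sum.swap) (simp add: sum_subtractf flip: sum_distrib_left)
  also have "\<dots> \<le> (\<Sum>u\<in>U. exp (- (u \<bullet> f u)) * (real (card J) * exp (- ((1 - R / 2) * c))))"
  proof (intro sum_mono mult_left_mono)
    fix u assume "u \<in> U"
    hence "u \<bullet> u = 1" using U by (simp add: eigenbasis_def dot_square_norm)
    with mean[of u] have "(1 - R / 2) * (real (card J) * c) \<le> (1 - R / 2) * (\<Sum>j\<in>J. u \<bullet> X j u)"
      using R(2) by (intro mult_left_mono) auto
    moreover have "real (card J) * (1 - (1 - R / 2) * c)
        \<le> real (card J) * exp (- ((1 - R / 2) * c))"
      using exp_ge_add_one_self[of "- ((1 - R / 2) * c)"] by (intro mult_left_mono) auto
    ultimately show "real (card J) - (1 - R / 2) * (\<Sum>j\<in>J. u \<bullet> X j u)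
        \<le> real (card J) * exp (- ((1 - R / 2) * c))"
      by (simp add: algebra_simps)
  qed simp
  also have "\<dots> = real (card J) * exp (- ((1 - R / 2) * c)) * trace_exp_neg f"
    by (simp add: eqU sum_distrib_left sum_distrib_right mult_ac)
  finally show ?thesis .
qed

subsection \<open>A Chernoff bound for sampled sums of operators\<close>

lemma finite_sample_lists: "finite (sample_lists mode n m)"
proof -
  have "finite {S :: nat list. set S \<subseteq> {1..n} \<and> length S = m}"
    by (rule finite_lists_length_eq) simp
  thus ?thesis by (rule rev_finite_subset) (cases mode; auto)
qed

lemma sample_listsD:
  assumes "S \<in> sample_lists mode n m"
  shows "length S = m" "set S \<subseteq> {1..n}"
  using assms by (cases mode; auto)+

fun next_indices :: "sampling \<Rightarrow> nat \<Rightarrow> nat list \<Rightarrow> nat set" where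
  "next_indices With_Replacement n S = {1..n}"
| "next_indices Without_Replacement n S = {1..n} - set S"

lemma finite_next_indices: "finite (next_indices mode n S)"
  by (cases mode) auto

text \<open>The newest index stands at the head of the list, so counting samples and bounding the
  potential become inductions on \<open>m\<close>.\<close>

lemma sum_sample_lists_Suc:
  "(\<Sum>S\<in>sample_lists mode n (Suc m). F S) =
     (\<Sum>S\<in>sample_lists mode n m. \<Sum>j\<in>next_indices mode n S. F (j # S))"
proof -
  have "(\<Sum>S\<in>sample_lists mode n m. \<Sum>j\<in>next_indices mode n S. F (j # S)) =
     (\<Sum>(S, j)\<in>Sigma (sample_lists mode n m) (next_indices mode n). F (j # S))"
    by (rule sum.Sigma) (simp_all add: finite_sample_lists finite_next_indices)
  also have "\<dots> = (\<Sum>S\<in>sample_lists mode n (Suc m). F S)"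
    by (rule sum.reindex_bij_witness[of _ "\<lambda>S. (tl S, hd S)" "\<lambda>(S, j). j # S"])
      (cases mode; force simp: length_Suc_conv)+
  finally show ?thesis by simp
qed

lemma card_next_indices:
  assumes "S \<in> sample_lists mode n m"
  shows "card (next_indices mode n S) =
    (case mode of With_Replacement \<Rightarrow> n | Without_Replacement \<Rightarrow> n - m)"
  using assms by (cases mode) (auto simp: card_Diff_subset distinct_card)

lemma card_sample_lists_Suc:
  "card (sample_lists mode n (Suc m)) =
     (case mode of With_Replacement \<Rightarrow> n | Without_Replacement \<Rightarrow> n - m)
       * card (sample_lists mode n m)"
  using sum_sample_lists_Suc[of "\<lambda>_. 1 :: nat" mode n m] by (simp add: card_next_indices)

lemma sample_lists_0: "sample_lists mode n 0 = {[]}"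
  by (cases mode) auto

text \<open>\<open>pmf_of_set\<close> is the uniform distribution only on nonempty finite sets. Here
  the product formula for the cardinality has positive factors.\<close>

lemma sample_lists_nonempty:
  assumes "1 \<le> n" "mode = Without_Replacement \<Longrightarrow> m \<le> n"
  shows "sample_lists mode n m \<noteq> {}"
proof -
  have "0 < card (sample_lists mode n m)"
    using assms
    by (induction m) (auto simp: sample_lists_0 card_sample_lists_Suc split: sampling.split)
  thus ?thesis by auto
qed

section \<open>Sums along a sample and the exchange of a drawn index\<close>

definition sample_sum :: "(nat \<Rightarrow> 'a::real_vector \<Rightarrow> 'a) \<Rightarrow> nat list \<Rightarrow> 'a \<Rightarrow> 'a" where
  "sample_sum X S v = (\<Sum>i\<leftarrow>S. X i v)"

lemma sample_sum_Cons: "sample_sum X (j # S) = (\<lambda>v. sample_sum X S v + X j v)"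
  by (simp add: sample_sum_def fun_eq_iff)

lemma sample_sum_update:
  assumes "k < length S"
  shows "sample_sum X (S[k := j]) v = sample_sum X S v - X (S ! k) v + X j v"
  using assms
proof (induction S arbitrary: k)
  case (Cons i S)
  thus ?case by (cases k) (auto simp: sample_sum_def)
qed simp

lemma self_adjoint_sample_sum:
  assumes "\<And>i. i \<in> set S \<Longrightarrow> self_adjoint (X i)"
  shows "self_adjoint (sample_sum X S)"
  using assms
proof (induction S)
  case Nil
  show ?case using self_adjoint_zero by (simp add: sample_sum_def[abs_def])
qed (simp add: sample_sum_Cons self_adjoint_add)

text \<open>Swapping the entry at position \<open>k\<close> with the fresh index \<open>j\<close> is
  an involution on pairs of a distinct list and an index outside it; the sum is reindexed along
  it.\<close>

lemma sum_without_replacement_exchange: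
  fixes G :: "nat list \<Rightarrow> nat \<Rightarrow> real"
  assumes "k < m"
  shows "(\<Sum>S\<in>sample_lists Without_Replacement n m. \<Sum>j\<in>{1..n} - set S. G (S[k := j]) j) =
     (\<Sum>S\<in>sample_lists Without_Replacement n m. \<Sum>j\<in>{1..n} - set S. G S (S ! k))"
proof -
  let ?L = "sample_lists Without_Replacement n m"
  let ?swap = "\<lambda>(S, j). (S[k := j], S ! k)"
  have nth: "S ! k \<in> {1..n}" "S ! k \<notin> set (S[k := j])" "set (S[k := j]) \<subseteq> {1..n}"
      "distinct (S[k := j])" "j \<notin> set S" "k < length S"
    if "S \<in> ?L" "j \<in> {1..n} - set S" for S j
  proof -
    have S: "distinct S" "k < length S" "set S \<subseteq> {1..n}" using that assms by auto
    show "S ! k \<in> {1..n}" "j \<notin> set S" "k < length S" using S that nth_mem by blast+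
    show "distinct (S[k := j])" using S that by (intro distinct_list_update) auto
    show "set (S[k := j]) \<subseteq> {1..n}" using S that set_update_subset_insert[of S k j] by blast
    show "S ! k \<notin> set (S[k := j])"
    proof
      assume "S ! k \<in> set (S[k := j])"
      then obtain i where i: "i < length S" "S[k := j] ! i = S ! k" by (auto simp: in_set_conv_nth)
      show False
      proof (cases "i = k")
        case True
        thus False using i S that nth_mem[of k S] by auto
      next
        case False
        thus False using i S by (simp add: nth_eq_iff_index_eq)
      qed
    qed
  qed
  have "(\<Sum>S\<in>?L. \<Sum>j\<in>{1..n} - set S. G (S[k := j]) j)
      = (\<Sum>(S, j)\<in>(SIGMA S:?L. {1..n} - set S). G (S[k := j]) j)"
    by (rule sum.Sigma) (simp_all add: finite_sample_lists del: sample_lists.simps)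
  also have "\<dots> = (\<Sum>(S, j)\<in>(SIGMA S:?L. {1..n} - set S). G S (S ! k))"
  proof (rule sum.reindex_bij_witness[of _ ?swap ?swap])
    fix a assume "a \<in> (SIGMA S:?L. {1..n} - set S)"
    then obtain S j where a: "a = (S, j)" "S \<in> ?L" "j \<in> {1..n} - set S" by auto
    note n = nth[OF a(2,3)]
    show "?swap (?swap a) = a" "?swap (?swap a) = a" using n a by simp_all
    show "?swap a \<in> (SIGMA S:?L. {1..n} - set S)" "?swap a \<in> (SIGMA S:?L. {1..n} - set S)"
      using n a by simp_all
    show "(case ?swap a of (S, j) \<Rightarrow> G S (S ! k)) = (case a of (S, j) \<Rightarrow> G (S[k := j]) j)"
      using n a by simp
  qed
  also have "\<dots> = (\<Sum>S\<in>?L. \<Sum>j\<in>{1..n} - set S. G S (S ! k))"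
    by (rule sum.Sigma[symmetric]) (simp_all add: finite_sample_lists del: sample_lists.simps)
  finally show ?thesis .
qed

text \<open>For \<open>k < m\<close> and a fresh index \<open>j\<close>, the sum over \<open>j # S\<close> is the midpoint of the sums over
  \<open>j # S[k := j]\<close> and \<open>S ! k # S\<close>, and both of these repeat an index. Exchanging \<open>j\<close> with \<open>S ! k\<close>
  shows that the two repeated terms have the same total.\<close>
lemma without_replacement_fresh_le_repeated:
  assumes X: "\<And>i. i \<in> {1..n} \<Longrightarrow> self_adjoint (X i)" and "m \<le> n"
  shows "real m * (\<Sum>S\<in>sample_lists Without_Replacement n m. \<Sum>j\<in>{1..n} - set S.
            trace_exp_neg (sample_sum X (j # S)))
    \<le> real (n - m) * (\<Sum>S\<in>sample_lists Without_Replacement n m. \<Sum>j\<in>set S.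
            trace_exp_neg (sample_sum X (j # S)))"
proof -
  let ?L = "sample_lists Without_Replacement n m"
  define P where "P S j = trace_exp_neg (sample_sum X (j # S))" for S j
  have conv: "2 * P S j \<le> P (S[k := j]) j + P S (S ! k)"
    if "S \<in> ?L" "j \<in> {1..n} - set S" "k < m" for S j k
  proof -
    have S: "set S \<subseteq> {1..n}" "k < length S" using that by auto
    hence "S ! k \<in> {1..n}" using nth_mem by blast
    hence sa: "self_adjoint (X j)" "self_adjoint (X (S ! k))" "self_adjoint (sample_sum X (j # S))"
      using that S by (auto intro!: X self_adjoint_sample_sum)
    have "sample_sum X (j # S[k := j])
        = (\<lambda>v. sample_sum X (j # S) v + (X j v - X (S ! k) v))"
      "sample_sum X (S ! k # S) = (\<lambda>v. sample_sum X (j # S) v - (X j v - X (S ! k) v))"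
      using S by (simp_all add: sample_sum_Cons sample_sum_update fun_eq_iff)
    thus ?thesis
      using trace_exp_neg_midpoint_convex[OF sa(3) self_adjoint_diff[OF sa(1,2)]]
      by (simp add: P_def)
  qed
  \<comment> \<open>Using every position \<open>k\<close> lets \<open>S ! k\<close> run through
    \<open>set S\<close>, whence the factor \<open>m\<close>. The factor \<open>n - m\<close> counts
    the fresh \<open>j\<close>, on which the exchanged terms no longer depend.\<close>
  have "2 * (real m * (\<Sum>S\<in>?L. \<Sum>j\<in>{1..n} - set S. P S j))
      = (\<Sum>k<m. \<Sum>S\<in>?L. \<Sum>j\<in>{1..n} - set S. 2 * P S j)"
    by (simp add: sum_distrib_left mult_ac)
  also have "\<dots> \<le> (\<Sum>k<m. \<Sum>S\<in>?L. \<Sum>j\<in>{1..n} - set S. P (S[k := j]) j + P S (S ! k))"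
    by (intro sum_mono conv) auto
  also have "\<dots> = (\<Sum>k<m. 2 * (\<Sum>S\<in>?L. \<Sum>j\<in>{1..n} - set S. P S (S ! k)))"
    by (intro sum.cong refl)
      (simp only: sum.distrib sum_without_replacement_exchange[of _ m P n] lessThan_iff mult_2)
  also have "\<dots> = 2 * (\<Sum>S\<in>?L. \<Sum>k<m. real (n - m) * P S (S ! k))"
  proof -
    have "(\<Sum>S\<in>?L. \<Sum>j\<in>{1..n} - set S. P S (S ! k)) = (\<Sum>S\<in>?L. real (n - m) * P S (S ! k))" for k
      using card_next_indices[of _ Without_Replacement n m]
      by (intro sum.cong refl) simp
    thus ?thesis by (subst sum.swap) (simp add: sum_distrib_left del: sample_lists.simps)
  qed
  also have "\<dots> = 2 * (real (n - m) * (\<Sum>S\<in>?L. \<Sum>j\<in>set S. P S j))"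
  proof -
    have "(\<Sum>k<m. P S (S ! k)) = (\<Sum>j\<in>set S. P S j)" if "S \<in> ?L" for S
      using that by (intro sum.reindex_bij_betw bij_betw_nth) auto
    thus ?thesis by (simp add: del: sample_lists.simps flip: sum_distrib_left)
  qed
  finally show ?thesis by (simp add: P_def)
qed

section \<open>Decay of the expected potential and the tail bound\<close>

text \<open>The one-draw bound controls the sum over all of \<open>{1..n}\<close>. Without
  replacement it splits into a fresh part \<open>A\<close> and a repeated part \<open>B\<close>;
  adding \<open>(n - m) * A\<close> to \<open>m * A \<le> (n - m) * B\<close> gives
  \<open>n * A \<le> (n - m) * (A + B)\<close>, the same decay per draw.\<close>

lemma sum_sample_lists_trace_exp_neg_Suc_le:
  fixes X :: "nat \<Rightarrow> 'a::euclidean_space \<Rightarrow> 'a"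
  assumes X: "\<And>i. i \<in> {1..n} \<Longrightarrow> self_adjoint (X i)"
    and R: "0 \<le> R" "R \<le> 2" "\<And>i v. i \<in> {1..n} \<Longrightarrow> X i v \<bullet> X i v \<le> R * (v \<bullet> X i v)"
    and mean: "\<And>v. real n * c * (v \<bullet> v) \<le> (\<Sum>i=1..n. v \<bullet> X i v)"
    and m: "mode = Without_Replacement \<Longrightarrow> m < n"
  shows "(\<Sum>S\<in>sample_lists mode n (Suc m). trace_exp_neg (sample_sum X S))
    \<le> real (case mode of With_Replacement \<Rightarrow> n | Without_Replacement \<Rightarrow> n - m)
        * exp (- ((1 - R / 2) * c))
        * (\<Sum>S\<in>sample_lists mode n m. trace_exp_neg (sample_sum X S))"
proof -
  let ?q = "exp (- ((1 - R / 2) * c))"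
  let ?W = "\<Sum>S\<in>sample_lists mode n m. trace_exp_neg (sample_sum X S)"
  have all: "(\<Sum>S\<in>sample_lists mode n m. \<Sum>j=1..n. trace_exp_neg (sample_sum X (j # S)))
      \<le> real n * ?q * ?W"
    unfolding sum_distrib_left
  proof (rule sum_mono)
    fix S assume "S \<in> sample_lists mode n m"
    hence "self_adjoint (sample_sum X S)"
      using sample_listsD(2) by (intro self_adjoint_sample_sum X) blast
    from sum_trace_exp_neg_add_le[OF this X R, where J = "{1..n}" and c = c] mean
    show "(\<Sum>j=1..n. trace_exp_neg (sample_sum X (j # S)))
        \<le> real n * ?q * trace_exp_neg (sample_sum X S)"
      by (simp add: sample_sum_Cons)
  qed
  show ?thesis
  proof (cases mode)
    case With_Replacement
    thus ?thesis using all by (simp only: sum_sample_lists_Suc) simp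
  next
    case Without_Replacement
    let ?L = "sample_lists Without_Replacement n m"
    let ?P = "\<lambda>S j. trace_exp_neg (sample_sum X (j # S))"
    define A where "A = (\<Sum>S\<in>?L. \<Sum>j\<in>{1..n} - set S. ?P S j)"
    define B where "B = (\<Sum>S\<in>?L. \<Sum>j\<in>set S. ?P S j)"
    have "m < n" using m Without_Replacement by simp
    have "(\<Sum>S\<in>?L. \<Sum>j=1..n. ?P S j) = A + B"
      unfolding A_def B_def sum.distrib[symmetric]
      by (intro sum.cong refl sum.subset_diff) auto
    with all have AB: "A + B \<le> real n * ?q * ?W" by (simp only: Without_Replacement)
    have "real m * A \<le> real (n - m) * B"
      unfolding A_def B_def
      using X \<open>m < n\<close> by (intro without_replacement_fresh_le_repeated) auto
    hence "real n * A \<le> real (n - m) * (A + B)"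
      using \<open>m < n\<close> by (simp add: of_nat_diff algebra_simps)
    also have "\<dots> \<le> real (n - m) * (real n * ?q * ?W)"
      using AB by (rule mult_left_mono) simp
    also have "\<dots> = real n * (real (n - m) * ?q * ?W)" by simp
    finally have "A \<le> real (n - m) * ?q * ?W" using \<open>m < n\<close> by simp
    thus ?thesis
      unfolding A_def by (simp only: sum_sample_lists_Suc Without_Replacement) simp
  qed
qed

lemma sum_sample_lists_trace_exp_neg_le:
  fixes X :: "nat \<Rightarrow> 'a::euclidean_space \<Rightarrow> 'a"
  assumes X: "\<And>i. i \<in> {1..n} \<Longrightarrow> self_adjoint (X i)"
    and R: "0 \<le> R" "R \<le> 2" "\<And>i v. i \<in> {1..n} \<Longrightarrow> X i v \<bullet> X i v \<le> R * (v \<bullet> X i v)"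
    and mean: "\<And>v. real n * c * (v \<bullet> v) \<le> (\<Sum>i=1..n. v \<bullet> X i v)"
    and m: "mode = Without_Replacement \<Longrightarrow> m \<le> n"
  shows "(\<Sum>S\<in>sample_lists mode n m. trace_exp_neg (sample_sum X S))
    \<le> real (card (sample_lists mode n m)) * exp (- ((1 - R / 2) * c)) ^ m * DIM('a)"
  using m
proof (induction m)
  case 0
  \<comment> \<open>The empty sample sums to the zero operator, whose potential is the dimension:
    the prefactor of the tail bound.\<close>
  show ?case
    by (simp add: sample_lists_0 sample_sum_def[abs_def] trace_exp_neg_zero)
next
  case (Suc m)
  let ?q = "exp (- ((1 - R / 2) * c))"
  let ?r = "real (case mode of With_Replacement \<Rightarrow> n | Without_Replacement \<Rightarrow> n - m)"
  have "(\<Sum>S\<in>sample_lists mode n (Suc m). trace_exp_neg (sample_sum X S))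
      \<le> ?r * ?q * (\<Sum>S\<in>sample_lists mode n m. trace_exp_neg (sample_sum X S))"
    using Suc.prems by (intro sum_sample_lists_trace_exp_neg_Suc_le X R mean) auto
  also have "\<dots> \<le> ?r * ?q * (real (card (sample_lists mode n m)) * ?q ^ m * DIM('a))"
    by (intro mult_left_mono Suc.IH) (use Suc.prems in auto)
  also have "\<dots> = real (card (sample_lists mode n (Suc m))) * ?q ^ Suc m * DIM('a)"
    by (simp only: card_sample_lists_Suc of_nat_mult power_Suc mult_ac)
  finally show ?case .
qed

theorem sampling_chernoff_lower_tail:
  fixes X :: "nat \<Rightarrow> 'a::euclidean_space \<Rightarrow> 'a"
  assumes "1 \<le> n"
    and X: "\<And>i. i \<in> {1..n} \<Longrightarrow> self_adjoint (X i)"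
    and R: "0 < R" "\<And>i v. i \<in> {1..n} \<Longrightarrow> X i v \<bullet> X i v \<le> R * (v \<bullet> X i v)"
    and mean: "\<And>v. real n * \<mu> * (v \<bullet> v) \<le> (\<Sum>i=1..n. v \<bullet> X i v)"
    and \<epsilon>: "0 < \<epsilon>" "\<epsilon> < 1"
    and m: "mode = Without_Replacement \<Longrightarrow> m \<le> n"
  shows "measure_pmf.prob (draw mode n m)
      {S. \<exists>v. v \<bullet> sample_sum X S v < (1 - \<epsilon>) * real m * \<mu> * (v \<bullet> v)}
    \<le> DIM('a) * exp (- (real m * \<mu> * \<epsilon>\<^sup>2 / (2 * R)))"
proof -
  let ?L = "sample_lists mode n m"
  \<comment> \<open>Scaling by a general \<theta> leads to the exponent \<open>real m * \<mu> *
    (\<theta>\<^sup>2 * R / 2 - \<epsilon> * \<theta>)\<close>; this choice minimizes the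
    bracket.\<close>
  define \<theta> where "\<theta> = \<epsilon> / R"
  define Y where "Y i v = \<theta> *\<^sub>R X i v" for i v
  define bad where "bad = {S. \<exists>v. v \<bullet> sample_sum X S v < (1 - \<epsilon>) * real m * \<mu> * (v \<bullet> v)}"
  define t where "t = \<theta> * ((1 - \<epsilon>) * real m * \<mu>)"
  have "0 < \<theta>" using \<epsilon> R by (simp add: \<theta>_def)
  have L: "?L \<noteq> {}" "finite ?L"
    using sample_lists_nonempty[OF \<open>1 \<le> n\<close>] m finite_sample_lists by auto
  have Y: "self_adjoint (Y i)" if "i \<in> {1..n}" for i
    unfolding Y_def[abs_def] by (intro self_adjoint_scale X that)
  have Y2: "Y i v \<bullet> Y i v \<le> \<epsilon> * (v \<bullet> Y i v)" if "i \<in> {1..n}" for i v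
  proof -
    have "Y i v \<bullet> Y i v = \<theta>\<^sup>2 * (X i v \<bullet> X i v)" by (simp add: Y_def power2_eq_square)
    also have "\<dots> \<le> \<theta>\<^sup>2 * (R * (v \<bullet> X i v))" using R(2)[OF that] by (intro mult_left_mono) auto
    also have "\<dots> = \<epsilon> * (v \<bullet> Y i v)" using R(1) by (simp add: Y_def \<theta>_def power2_eq_square)
    finally show ?thesis .
  qed
  have Ymean: "real n * (\<theta> * \<mu>) * (v \<bullet> v) \<le> (\<Sum>i=1..n. v \<bullet> Y i v)" for v
    using mult_left_mono[OF mean[of v], of \<theta>] \<open>0 < \<theta>\<close>
    by (simp add: Y_def sum_distrib_left mult_ac)
  have sumY: "sample_sum Y S v = \<theta> *\<^sub>R sample_sum X S v" for S v
    by (induction S) (simp_all add: sample_sum_def Y_def scaleR_add_right)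
  have large: "exp (- t) \<le> trace_exp_neg (sample_sum Y S)" if "S \<in> ?L" "S \<in> bad" for S
  proof -
    from that(2) obtain v where "v \<bullet> sample_sum X S v < (1 - \<epsilon>) * real m * \<mu> * (v \<bullet> v)"
      by (auto simp: bad_def)
    from mult_strict_left_mono[OF this \<open>0 < \<theta>\<close>]
    have "v \<bullet> sample_sum Y S v < t * (v \<bullet> v)" by (simp add: sumY t_def mult_ac)
    moreover have "self_adjoint (sample_sum Y S)"
      using sample_listsD(2)[OF that(1)] by (intro self_adjoint_sample_sum Y) blast
    ultimately show ?thesis by (intro exp_le_trace_exp_neg)
  qed
  \<comment> \<open>Markov's inequality in counting form: each bad sample contributes at least
    \<open>exp (- t)\<close> to the total potential.\<close>
  have "real (card (?L \<inter> bad)) * exp (- t) = (\<Sum>S\<in>?L \<inter> bad. exp (- t))" by simp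
  also have "\<dots> \<le> (\<Sum>S\<in>?L \<inter> bad. trace_exp_neg (sample_sum Y S))"
    using large by (intro sum_mono) auto
  also have "\<dots> \<le> (\<Sum>S\<in>?L. trace_exp_neg (sample_sum Y S))"
    using L by (intro sum_mono2) (auto simp: trace_exp_neg_nonneg)
  also have "\<dots> \<le> real (card ?L) * exp (- ((1 - \<epsilon> / 2) * (\<theta> * \<mu>))) ^ m * DIM('a)"
    using \<epsilon> m by (intro sum_sample_lists_trace_exp_neg_le Y Y2 Ymean) auto
  finally have "real (card (?L \<inter> bad))
      \<le> real (card ?L) * exp (- ((1 - \<epsilon> / 2) * (\<theta> * \<mu>))) ^ m * DIM('a) * exp t"
    by (simp add: exp_minus field_simps)
  hence "real (card (?L \<inter> bad)) / real (card ?L)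
      \<le> DIM('a) * (exp (- ((1 - \<epsilon> / 2) * (\<theta> * \<mu>))) ^ m * exp t)"
    using L by (simp add: divide_simps card_gt_0_iff mult_ac)
  also have "exp (- ((1 - \<epsilon> / 2) * (\<theta> * \<mu>))) ^ m * exp t
      = exp (real m * (- ((1 - \<epsilon> / 2) * (\<theta> * \<mu>))) + t)"
    by (simp only: exp_add exp_of_nat_mult)
  also have "real m * (- ((1 - \<epsilon> / 2) * (\<theta> * \<mu>))) + t = - (real m * \<mu> * \<epsilon>\<^sup>2 / (2 * R))"
    using R(1) by (simp add: t_def \<theta>_def field_simps power2_eq_square)
  finally show ?thesis
    using L by (simp add: draw_def measure_pmf_of_set bad_def)
qed

subsection \<open>Gradient and Hessian\<close>

lemma GDERIV_unique:
  fixes f :: "'a::euclidean_space \<Rightarrow> real"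
  assumes "GDERIV f x :> a" "GDERIV f x :> b"
  shows "a = b"
proof -
  have "(\<lambda>h. h \<bullet> a) = (\<lambda>h. h \<bullet> b)"
    using assms unfolding gderiv_def by (rule has_derivative_unique)
  hence "\<And>h. h \<bullet> a = h \<bullet> b" by meson
  thus ?thesis by (metis vector_eq_ldot)
qed

lemma grad_eqI: "GDERIV f x :> g \<Longrightarrow> grad f x = g"
  unfolding grad_def using GDERIV_unique by blast

text \<open>The derivative is a linear functional, represented by the vector of its values on the
  standard basis. With uniqueness this gives meaning to the description in
  \<open>grad\<close>.\<close>

lemma GDERIV_grad:
  fixes f :: "real^'p \<Rightarrow> real"
  assumes "f differentiable (at x)"
  shows "GDERIV f x :> grad f x"
proof -
  obtain D where D: "(f has_derivative D) (at x)"
    using assms by (auto simp: differentiable_def)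
  interpret D: linear D using D by (rule has_derivative_linear)
  have "D h = h \<bullet> (\<Sum>b\<in>Basis. D b *\<^sub>R b)" for h
  proof -
    have "D h = D (\<Sum>b\<in>Basis. (h \<bullet> b) *\<^sub>R b)" by (simp add: euclidean_representation)
    also have "\<dots> = h \<bullet> (\<Sum>b\<in>Basis. D b *\<^sub>R b)"
      by (simp add: D.sum D.scale inner_sum_right mult.commute)
    finally show ?thesis .
  qed
  hence "D = (\<lambda>h. h \<bullet> (\<Sum>b\<in>Basis. D b *\<^sub>R b))" by (rule ext)
  with D have "GDERIV f x :> (\<Sum>b\<in>Basis. D b *\<^sub>R b)"
    unfolding gderiv_def by simp
  thus ?thesis using grad_eqI by metis
qed

lemma grad_has_derivative:
  assumes "twice_differentiable f"
  shows "(f has_derivative (\<lambda>h. h \<bullet> grad f x)) (at x)"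
  using assms GDERIV_grad unfolding twice_differentiable_def gderiv_def by blast

lemma hessian_has_derivative:
  assumes "twice_differentiable f"
  shows "(grad f has_derivative (\<lambda>h. hessian f x *v h)) (at x)"
  using assms jacobian_works unfolding twice_differentiable_def hessian_def by blast

lemma average_has_derivative:
  assumes "\<And>i. i \<in> {1..n} \<Longrightarrow> twice_differentiable (f i)"
  shows "(average n f has_derivative (\<lambda>h. h \<bullet> ((1 / real n) *\<^sub>R (\<Sum>i=1..n. grad (f i) x)))) (at x)"
proof -
  have "((\<lambda>x. (1 / real n) * (\<Sum>i=1..n. f i x)) has_derivative
      (\<lambda>h. (1 / real n) * (\<Sum>i=1..n. h \<bullet> grad (f i) x))) (at x)"
    using assms by (intro has_derivative_mult_right has_derivative_sum grad_has_derivative)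
  thus ?thesis by (simp add: average_def[abs_def] inner_sum_right)
qed

lemma grad_average:
  assumes "\<And>i. i \<in> {1..n} \<Longrightarrow> twice_differentiable (f i)"
  shows "grad (average n f) = (\<lambda>x. (1 / real n) *\<^sub>R (\<Sum>i=1..n. grad (f i) x))"
  using average_has_derivative[of n f, OF assms] by (intro ext grad_eqI) (simp add: gderiv_def)

lemma grad_average_has_derivative:
  assumes "\<And>i. i \<in> {1..n} \<Longrightarrow> twice_differentiable (f i)"
  shows "(grad (average n f) has_derivative
      (\<lambda>h. (1 / real n) *\<^sub>R (\<Sum>i=1..n. hessian (f i) x *v h))) (at x)"
  by (subst grad_average[of n f, OF assms], assumption)
    (intro has_derivative_scaleR_right has_derivative_sum hessian_has_derivative assms)

lemma twice_differentiable_average: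
  assumes "\<And>i. i \<in> {1..n} \<Longrightarrow> twice_differentiable (f i)"
  shows "twice_differentiable (average n f)"
  unfolding twice_differentiable_def differentiable_def
  using average_has_derivative[of n f, OF assms] grad_average_has_derivative[of n f, OF assms]
  by blast

lemma hessian_average:
  assumes "\<And>i. i \<in> {1..n} \<Longrightarrow> twice_differentiable (f i)"
  shows "hessian (average n f) x *v h = (1 / real n) *\<^sub>R (\<Sum>i=1..n. hessian (f i) x *v h)"
  using has_derivative_unique[OF hessian_has_derivative[OF twice_differentiable_average[of n f, OF assms]]
      grad_average_has_derivative[of n f, OF assms]]
  by meson

text \<open>Maclaurin's theorem of order 2 on the segment from \<open>x\<close> to
  \<open>x + d\<close>. The Lagrange remainder asks only for existence of the second derivative,
  which is what \<open>twice_differentiable\<close> supplies.\<close>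

lemma second_order_taylor:
  assumes F: "twice_differentiable F"
  obtains z where "F (x + d) = F x + d \<bullet> grad F x + (d \<bullet> (hessian F z *v d)) / 2"
proof -
  define \<phi> where "\<phi> t = F (x + t *\<^sub>R d)" for t :: real
  define \<phi>1 where "\<phi>1 t = d \<bullet> grad F (x + t *\<^sub>R d)" for t :: real
  define \<phi>2 where "\<phi>2 t = d \<bullet> (hessian F (x + t *\<^sub>R d) *v d)" for t :: real
  have line: "((\<lambda>t. x + t *\<^sub>R d) has_derivative (\<lambda>s. s *\<^sub>R d)) (at t)" for t
    by (auto intro!: derivative_eq_intros)
  have "(\<phi> has_real_derivative \<phi>1 t) (at t)" for t
    using has_derivative_compose[OF line grad_has_derivative[OF F], of t]
    by (simp add: \<phi>_def[abs_def] \<phi>1_def has_field_derivative_def mult_commute_abs)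
  moreover have "(\<phi>1 has_real_derivative \<phi>2 t) (at t)" for t
    using has_derivative_inner_right[OF has_derivative_compose[OF line hessian_has_derivative[OF F]],
        of d t]
    by (simp add: \<phi>1_def[abs_def] \<phi>2_def has_field_derivative_def mult_commute_abs
        matrix_vector_mult_scaleR)
  ultimately have "\<forall>m t. m < 2 \<and> 0 \<le> t \<and> t \<le> 1 \<longrightarrow>
      ((if m = 0 then \<phi> else if m = 1 then \<phi>1 else \<phi>2) has_real_derivative
       (if Suc m = 0 then \<phi> else if Suc m = 1 then \<phi>1 else \<phi>2) t) (at t)"
    by (auto simp: less_2_cases_iff)
  from Maclaurin[OF _ _ _ this, of \<phi>]
  obtain t where "\<phi> 1 = \<phi> 0 + \<phi>1 0 + \<phi>2 t / 2"
    by (auto simp: lessThan_nat_numeral eval_nat_numeral)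
  thus ?thesis by (intro that[of "x + t *\<^sub>R d"]) (simp add: \<phi>_def \<phi>1_def \<phi>2_def)
qed

text \<open>For a minimizer \<open>y\<close> this is the Polyak-Lojasiewicz inequality. The
  quadratic lower model of \<open>F\<close> at \<open>x\<close> is estimated by completing the
  square.\<close>

lemma strong_convexity_gap_le:
  assumes F: "twice_differentiable F" and "0 < \<gamma>"
    and low: "\<And>y v. \<gamma> * (v \<bullet> v) \<le> v \<bullet> (hessian F y *v v)"
  shows "F x - F y \<le> (grad F x \<bullet> grad F x) / (2 * \<gamma>)"
proof -
  let ?g = "grad F x"
  define d where "d = y - x"
  obtain z where z: "F (x + d) = F x + d \<bullet> ?g + (d \<bullet> (hessian F z *v d)) / 2"
    by (rule second_order_taylor[OF F])
  have "0 \<le> (?g + \<gamma> *\<^sub>R d) \<bullet> (?g + \<gamma> *\<^sub>R d)" by simp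
  also have "\<dots> = ?g \<bullet> ?g + 2 * \<gamma> * (d \<bullet> ?g + \<gamma> * (d \<bullet> d) / 2)"
    by (simp add: inner_add_left inner_add_right inner_commute[of ?g d] algebra_simps)
  also have "\<dots> \<le> ?g \<bullet> ?g + 2 * \<gamma> * (F y - F x)"
    using low[of d z] z \<open>0 < \<gamma>\<close> by (intro add_left_mono mult_left_mono) (auto simp: d_def)
  finally show ?thesis using \<open>0 < \<gamma>\<close> by (simp add: field_simps)
qed

subsection \<open>Descent with an inexact Newton direction\<close>

text \<open>In operator terms, the square of \<open>f\<close> is at most \<open>K\<close> times
  \<open>f\<close>. Positivity tested at \<open>K *\<^sub>R v - f v\<close> gives this without a
  square root of \<open>f\<close>.\<close>

lemma psd_norm_square_le:
  assumes f: "self_adjoint f" and psd: "\<And>v. 0 \<le> v \<bullet> f v" and "0 < K"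
    and up: "\<And>v. v \<bullet> f v \<le> K * (v \<bullet> v)"
  shows "f v \<bullet> f v \<le> K * (v \<bullet> f v)"
proof -
  interpret linear f using f by (rule self_adjoint_linear)
  let ?w = "f v"
  have "v \<bullet> f ?w = ?w \<bullet> ?w" using self_adjoint_inner[OF f, of v ?w] by simp
  hence "(K *\<^sub>R v - ?w) \<bullet> f (K *\<^sub>R v - ?w)
      = K\<^sup>2 * (v \<bullet> ?w) - 2 * K * (?w \<bullet> ?w) + ?w \<bullet> f ?w"
    by (simp add: diff scale inner_diff_left inner_diff_right algebra_simps power2_eq_square)
  with psd[of "K *\<^sub>R v - ?w"] up[of ?w] have "K * (?w \<bullet> ?w) \<le> K * (K * (v \<bullet> ?w))"
    by (simp add: power2_eq_square)
  thus ?thesis using \<open>0 < K\<close> by simp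
qed

text \<open>With \<open>f u = g\<close> and \<open>f v = r\<close> this is Cauchy-Schwarz for the form \<open>u \<bullet> f v\<close>: the residual costs
  at most half of \<open>u \<bullet> f u\<close>.\<close>
lemma inexact_solve_decrease:
  assumes f: "self_adjoint f" and "0 < \<mu>" "0 < L"
    and low: "\<And>v. \<mu> * (v \<bullet> v) \<le> v \<bullet> f v" and up: "\<And>v. v \<bullet> f v \<le> L * (v \<bullet> v)"
    and g: "g = f w + r" and r: "r \<bullet> r \<le> \<mu> / (4 * L) * (g \<bullet> g)"
  shows "(g \<bullet> g) / (2 * L) \<le> w \<bullet> g"
proof -
  interpret linear f using f by (rule self_adjoint_linear)
  have psd: "0 \<le> v \<bullet> f v" for v
    using low[of v] \<open>0 < \<mu>\<close> by (meson inner_ge_zero mult_nonneg_nonneg order_trans less_imp_le)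
  \<comment> \<open>Definiteness makes \<open>f\<close> invertible, so the residual has the form
    \<open>r = f v\<close>.\<close>
  have "v = 0" if "f v = 0" for v
  proof -
    have "\<not> 0 < v \<bullet> v" using low[of v] that \<open>0 < \<mu>\<close> by (simp add: mult_le_0_iff not_less del: inner_gt_zero_iff)
    thus ?thesis by (simp only: inner_gt_zero_iff not_not)
  qed
  hence "inj f" using linear_injective_0[OF linear_axioms] by blast
  hence "surj f" using linear_axioms by (simp add: linear_injective_imp_surjective)
  then obtain v where v: "f v = r" by (metis surjD)
  define u where "u = w + v"
  have fu: "f u = g" by (simp add: u_def add v g)
  \<comment> \<open>This square yields \<open>\<mu> * (v \<bullet> f v) \<le> r \<bullet> r\<close>,
    that is, the inverse of \<open>f\<close> is at most \<open>1 / \<mu>\<close>.\<close>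
  have "0 \<le> (r - \<mu> *\<^sub>R v) \<bullet> (r - \<mu> *\<^sub>R v)" by simp
  also have "\<dots> = r \<bullet> r - 2 * \<mu> * (v \<bullet> f v) + \<mu> * (\<mu> * (v \<bullet> v))"
    by (simp add: v inner_diff_left inner_diff_right inner_commute[of r v] algebra_simps)
  also have "\<dots> \<le> r \<bullet> r - 2 * \<mu> * (v \<bullet> f v) + \<mu> * (v \<bullet> f v)"
    using low[of v] \<open>0 < \<mu>\<close> by simp
  finally have "\<mu> * (v \<bullet> f v) \<le> \<mu> * ((g \<bullet> g) / (4 * L))" using r by simp
  hence vv: "v \<bullet> f v \<le> (g \<bullet> g) / (4 * L)" using \<open>0 < \<mu>\<close> by (rule mult_left_le_imp_le)
  have gg: "(g \<bullet> g) / L \<le> u \<bullet> f u"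
    using psd_norm_square_le[OF f psd \<open>0 < L\<close> up, of u] \<open>0 < L\<close> by (simp add: fu field_simps)
  have "u \<bullet> f v = v \<bullet> f u" by (metis inner_commute self_adjoint_inner[OF f])
  \<comment> \<open>The weight \<open>1/2\<close> charges a quarter of
    \<open>u \<bullet> f u\<close> to the cross term, and \<open>v \<bullet> f v\<close> costs
    another quarter of \<open>(g \<bullet> g) / L\<close>; half remains.\<close>
  hence "((1/2) *\<^sub>R u - v) \<bullet> f ((1/2) *\<^sub>R u - v) = (u \<bullet> f u) / 4 - v \<bullet> f u + v \<bullet> f v"
    by (simp add: diff scale inner_diff_left inner_diff_right algebra_simps)
  with psd[of "(1/2) *\<^sub>R u - v"] have "v \<bullet> f u \<le> (u \<bullet> f u) / 4 + v \<bullet> f v" by simp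
  moreover have "w \<bullet> g = u \<bullet> f u - v \<bullet> f u" by (simp only: fu) (simp add: u_def inner_add_left)
  ultimately show ?thesis using vv gg by (simp add: field_simps)
qed

text \<open>Taylor's upper model shows that the minimum on the left satisfies the Armijo condition,
  and \<alpha> is the largest such step. Taking the minimum with \<open>\<alpha>hat\<close> respects
  the cap on step sizes.\<close>

lemma armijo_step_lower_bound:
  assumes F: "twice_differentiable F" and "0 < K" "0 < c" "\<beta> < 1"
    and up: "\<And>y v. v \<bullet> (hessian F y *v v) \<le> K * (v \<bullet> v)"
    and descent: "p \<bullet> grad F x \<le> - c * (p \<bullet> p)"
    and step: "armijo_step F \<beta> \<alpha>hat x p \<alpha>" and "0 \<le> \<alpha>hat"
  shows "min \<alpha>hat (2 * c * (1 - \<beta>) / K) \<le> \<alpha>"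
proof -
  define a where "a = min \<alpha>hat (2 * c * (1 - \<beta>) / K)"
  have "0 \<le> a" using assms by (simp add: a_def)
  obtain z where z: "F (x + a *\<^sub>R p) =
      F x + (a *\<^sub>R p) \<bullet> grad F x + ((a *\<^sub>R p) \<bullet> (hessian F z *v (a *\<^sub>R p))) / 2"
    by (rule second_order_taylor[OF F])
  have "a \<le> 2 * c * (1 - \<beta>) / K" by (simp add: a_def)
  hence "a * K \<le> 2 * c * (1 - \<beta>)" using \<open>0 < K\<close> by (simp only: pos_le_divide_eq)
  hence "a * K * (p \<bullet> p) \<le> 2 * c * (1 - \<beta>) * (p \<bullet> p)" by (rule mult_right_mono) simp
  also have "\<dots> \<le> 2 * (1 - \<beta>) * - (p \<bullet> grad F x)"
    using mult_left_mono[OF descent, of "2 * (1 - \<beta>)"] \<open>\<beta> < 1\<close> by (simp add: algebra_simps)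
  finally have "a * (a * K * (p \<bullet> p)) \<le> a * (2 * (1 - \<beta>) * - (p \<bullet> grad F x))"
    using \<open>0 \<le> a\<close> by (rule mult_left_mono)
  moreover have "(a *\<^sub>R p) \<bullet> (hessian F z *v (a *\<^sub>R p)) \<le> a * (a * K * (p \<bullet> p))"
    using up[of "a *\<^sub>R p" z] by (simp add: mult_ac)
  ultimately have "armijo F \<beta> x p a"
    unfolding armijo_def z by (simp add: algebra_simps)
  thus ?thesis using step by (simp add: armijo_step_def a_def)
qed

text \<open>The deterministic part. \<open>L\<close> bounds the sampled Hessian from above, and
  \<open>L / \<gamma>\<close> is later \<open>kappa_tilde\<close>. Both rates follow from one lower
  bound on \<open>- (p \<bullet> grad F x)\<close>.\<close>

lemma newton_iteration_bounds:
  fixes H :: "real^'p^'p"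
  assumes F: "twice_differentiable F" and "0 < \<gamma>" "0 < K"
    and low: "\<And>y v. \<gamma> * (v \<bullet> v) \<le> v \<bullet> (hessian F y *v v)"
    and up: "\<And>y v. v \<bullet> (hessian F y *v v) \<le> K * (v \<bullet> v)"
    and xstar: "\<And>y. F xstar \<le> F y"
    and H: "self_adjoint ((*v) H)" and "0 < L"
    and Hlow: "\<And>v. (1 - \<epsilon>) * \<gamma> * (v \<bullet> v) \<le> v \<bullet> (H *v v)"
    and Hup: "\<And>v. v \<bullet> (H *v v) \<le> L * (v \<bullet> v)"
    and params: "0 \<le> \<theta>1" "\<theta>1 < 1" "\<theta>2 < 1" "0 < \<beta>" "\<beta> < 1" "\<epsilon> < 1" "0 < \<alpha>hat"
    and dir: "inexact_direction \<theta>1 \<theta>2 H (grad F x) p"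
    and step: "armijo_step F \<beta> \<alpha>hat x p \<alpha>"
  shows "F (x + \<alpha> *\<^sub>R p) - F xstar \<le> (1 - rate \<theta>1 \<theta>2 \<epsilon> \<beta> (L / \<gamma>) \<alpha>) * (F x - F xstar)"
    and "min \<alpha>hat (2 * (1 - \<theta>2) * (1 - \<beta>) * (1 - \<epsilon>) / (K / \<gamma>)) \<le> \<alpha>"
proof -
  let ?g = "grad F x"
  define \<mu> where "\<mu> = (1 - \<epsilon>) * \<gamma>"
  have "0 < \<mu>" using params \<open>0 < \<gamma>\<close> by (simp add: \<mu>_def)
  note Hlow = Hlow[folded \<mu>_def]
  have res: "norm (H *v p + ?g) \<le> \<theta>1 * norm ?g"
    and curv: "p \<bullet> ?g \<le> - (1 - \<theta>2) * (p \<bullet> (H *v p))"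
    using dir by (auto simp: inexact_direction_def)
  have "(1 - \<theta>2) * (\<mu> * (p \<bullet> p)) \<le> (1 - \<theta>2) * (p \<bullet> (H *v p))"
    using params by (intro mult_left_mono Hlow) simp
  with curv have descent: "p \<bullet> ?g \<le> - ((1 - \<theta>2) * \<mu>) * (p \<bullet> p)" by (simp add: algebra_simps)
  have "min \<alpha>hat (2 * ((1 - \<theta>2) * \<mu>) * (1 - \<beta>) / K) \<le> \<alpha>"
    using params \<open>0 < \<mu>\<close> \<open>0 < K\<close>
    by (intro armijo_step_lower_bound[OF F _ _ _ up descent step]) simp_all
  also have "2 * ((1 - \<theta>2) * \<mu>) * (1 - \<beta>) / K = 2 * (1 - \<theta>2) * (1 - \<beta>) * (1 - \<epsilon>) / (K / \<gamma>)"
    by (simp add: \<mu>_def)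
  finally show alpha: "min \<alpha>hat (2 * (1 - \<theta>2) * (1 - \<beta>) * (1 - \<epsilon>) / (K / \<gamma>)) \<le> \<alpha>" .
  have "0 < min \<alpha>hat (2 * (1 - \<theta>2) * (1 - \<beta>) * (1 - \<epsilon>) / (K / \<gamma>))"
    using params \<open>0 < \<gamma>\<close> \<open>0 < K\<close> by simp
  with alpha have "0 < \<alpha>" by (rule less_le_trans[rotated])
  \<comment> \<open>The rate without its factor \<open>\<alpha> * \<beta>\<close>, so that both
    cases share the closing argument.\<close>
  define \<sigma> where "\<sigma> = (if \<theta>1 \<le> sqrt ((1 - \<epsilon>) / (4 * (L / \<gamma>))) then 1 / (L / \<gamma>)
      else 2 * (1 - \<theta>2) * (1 - \<theta>1)\<^sup>2 * (1 - \<epsilon>) / (L / \<gamma>)\<^sup>2)"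
  have rate: "rate \<theta>1 \<theta>2 \<epsilon> \<beta> (L / \<gamma>) \<alpha> = \<alpha> * \<beta> * \<sigma>"
    by (simp add: rate_def \<sigma>_def)
  have "0 \<le> \<sigma>" using params \<open>0 < L\<close> \<open>0 < \<gamma>\<close> by (simp add: \<sigma>_def)
  have decrease: "\<sigma> * ((?g \<bullet> ?g) / (2 * \<gamma>)) \<le> - (p \<bullet> ?g)"
  proof (cases "\<theta>1 \<le> sqrt ((1 - \<epsilon>) / (4 * (L / \<gamma>)))")
    case True
    define r where "r = H *v p + ?g"
    \<comment> \<open>Squared, the threshold on \<open>\<theta>1\<close> is exactly the residual
      tolerance of \<open>inexact_solve_decrease\<close>, used below with
      \<open>w = - p\<close>.\<close>
    have "\<theta>1\<^sup>2 \<le> (sqrt ((1 - \<epsilon>) / (4 * (L / \<gamma>))))\<^sup>2"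
      using True params by (intro power_mono)
    also have "\<dots> = \<mu> / (4 * L)" using params \<open>0 < L\<close> \<open>0 < \<gamma>\<close> by (simp add: \<mu>_def)
    finally have th: "\<theta>1\<^sup>2 \<le> \<mu> / (4 * L)" .
    have "r \<bullet> r \<le> (\<theta>1 * norm ?g)\<^sup>2"
      using res by (simp add: r_def power_mono flip: power2_norm_eq_inner)
    also have "\<dots> \<le> \<mu> / (4 * L) * (?g \<bullet> ?g)"
      using mult_right_mono[OF th, of "?g \<bullet> ?g"]
      by (simp add: power_mult_distrib power2_norm_eq_inner)
    finally have "(?g \<bullet> ?g) / (2 * L) \<le> - p \<bullet> ?g"
      using \<open>0 < \<mu>\<close> \<open>0 < L\<close>
      by (intro inexact_solve_decrease[OF H _ _ Hlow Hup, of "grad F x" "- p" r])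
        (simp_all add: r_def linear_neg[OF self_adjoint_linear[OF H]])
    thus ?thesis using True \<open>0 < \<gamma>\<close> by (simp add: \<sigma>_def)
  next
    case False
    have psd: "0 \<le> v \<bullet> (H *v v)" for v
      using Hlow[of v] \<open>0 < \<mu>\<close> by (meson inner_ge_zero mult_nonneg_nonneg order_trans less_imp_le)
    \<comment> \<open>Here the residual only forces \<open>p\<close> to be long:
      \<open>H *v p\<close> has norm at least \<open>(1 - \<theta>1) * norm ?g\<close> and at most
      \<open>L * norm p\<close>. The curvature condition turns this length into descent.\<close>
    have "norm ?g - norm (H *v p) \<le> norm (H *v p + ?g)"
      by (metis add.commute norm_diff_ineq)
    with res have "(1 - \<theta>1) * norm ?g \<le> norm (H *v p)" by (simp add: algebra_simps)
    hence "((1 - \<theta>1) * norm ?g)\<^sup>2 \<le> (norm (H *v p))\<^sup>2"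
      using params by (intro power_mono) auto
    also have "\<dots> \<le> L * (p \<bullet> (H *v p))"
      using psd_norm_square_le[OF H psd \<open>0 < L\<close> Hup] by (simp add: power2_norm_eq_inner)
    also have "\<dots> \<le> L * (L * (p \<bullet> p))" using Hup \<open>0 < L\<close> by (intro mult_left_mono) auto
    finally have "(1 - \<theta>1)\<^sup>2 * (?g \<bullet> ?g) \<le> L\<^sup>2 * (p \<bullet> p)"
      by (simp add: power_mult_distrib power2_norm_eq_inner) (simp add: power2_eq_square mult.assoc)
    hence "(1 - \<theta>1)\<^sup>2 * (?g \<bullet> ?g) / L\<^sup>2 \<le> p \<bullet> p"
      using \<open>0 < L\<close> by (simp add: divide_le_eq mult.commute)
    hence "((1 - \<theta>2) * \<mu>) * ((1 - \<theta>1)\<^sup>2 * (?g \<bullet> ?g) / L\<^sup>2) \<le> ((1 - \<theta>2) * \<mu>) * (p \<bullet> p)"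
      using params \<open>0 < \<mu>\<close> by (intro mult_left_mono) auto
    also have "\<dots> \<le> - (p \<bullet> ?g)" using descent by simp
    also have "((1 - \<theta>2) * \<mu>) * ((1 - \<theta>1)\<^sup>2 * (?g \<bullet> ?g) / L\<^sup>2) = \<sigma> * ((?g \<bullet> ?g) / (2 * \<gamma>))"
    proof -
      have "a * (e * \<gamma>) * (t * G / L\<^sup>2) = 2 * a * t * e / (L / \<gamma>)\<^sup>2 * (G / (2 * \<gamma>))" for a e t G
        using \<open>0 < \<gamma>\<close> \<open>0 < L\<close> by (simp add: field_simps power2_eq_square)
      thus ?thesis using False by (simp only: \<sigma>_def \<mu>_def if_False)
    qed
    finally show ?thesis .
  qed
  have "\<sigma> * (F x - F xstar) \<le> \<sigma> * ((?g \<bullet> ?g) / (2 * \<gamma>))"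
    using \<open>0 \<le> \<sigma>\<close> by (intro mult_left_mono strong_convexity_gap_le[OF F \<open>0 < \<gamma>\<close> low])
  with decrease have "\<sigma> * (F x - F xstar) \<le> - (p \<bullet> ?g)" by simp
  hence "\<alpha> * \<beta> * (\<sigma> * (F x - F xstar)) \<le> \<alpha> * \<beta> * - (p \<bullet> ?g)"
    using \<open>0 < \<alpha>\<close> params by (intro mult_left_mono) auto
  moreover have "F (x + \<alpha> *\<^sub>R p) \<le> F x + \<alpha> * \<beta> * (p \<bullet> ?g)"
    using step by (simp add: armijo_step_def armijo_def)
  ultimately show "F (x + \<alpha> *\<^sub>R p) - F xstar
      \<le> (1 - rate \<theta>1 \<theta>2 \<epsilon> \<beta> (L / \<gamma>) \<alpha>) * (F x - F xstar)"
    unfolding rate by (simp add: algebra_simps)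
qed

subsection \<open>Bounds for the sub-sampled Hessian\<close>

text \<open>A greedy comparison: remove \<open>y\<close> from \<open>M\<close> if it occurs there,
  otherwise any element, which is at most \<open>y\<close>; the rest lies in
  \<open>ys\<close>.\<close>

lemma sum_mset_le_sum_list_take:
  fixes ys :: "real list"
  assumes "sorted_wrt (\<ge>) ys" "M \<subseteq># mset ys"
  shows "sum_mset M \<le> sum_list (take (size M) ys)"
  using assms
proof (induction ys arbitrary: M)
  case (Cons y ys)
  show ?case
  proof (cases "M = {#}")
    case False
    then obtain z where z: "z \<in># M" "y \<in># M \<Longrightarrow> z = y" by blast
    define M' where "M' = M - {#z#}"
    have M: "M = add_mset z M'" using z by (simp add: M'_def)
    have "z \<in># mset (y # ys)" using z(1) Cons.prems(2) by (rule mset_subset_eqD[rotated])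
    hence "z \<le> y" using Cons.prems(1) by auto
    have "M' \<subseteq># mset ys"
    proof (cases "z = y")
      case True
      thus ?thesis using Cons.prems(2) M by simp
    next
      case False
      hence "y \<notin># M" using z(2) by blast
      hence "M \<subseteq># mset ys"
        using Cons.prems(2) by (metis diff_single_trivial mset.simps(2) subset_eq_diff_conv add_mset_add_single)
      thus ?thesis unfolding M'_def using diff_subset_eq_self subset_mset.order_trans by blast
    qed
    hence "sum_mset M' \<le> sum_list (take (size M') ys)" using Cons by simp
    thus ?thesis using \<open>z \<le> y\<close> by (simp add: M)
  qed simp
qed simp

text \<open>Distinct indices pick a sub-multiset of all the values. Singleton lists show that
  \<open>K_hat n Ks 1\<close> bounds every \<open>Ks i\<close>.\<close>

lemma sum_list_le_K_hat:
  assumes "distinct S" "set S \<subseteq> {1..n}" "S \<noteq> []"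
  shows "(\<Sum>i\<leftarrow>S. Ks i) \<le> real (length S) * K_hat n Ks (length S)"
proof -
  let ?ys = "rev (sort (map Ks [1..<Suc n]))"
  have "mset S = mset_set (set S)" using assms by (simp add: mset_set_set)
  also have "\<dots> \<subseteq># mset_set (set [1..<Suc n])"
    using assms by (intro subset_imp_msubset_mset_set) auto
  also have "\<dots> = mset [1..<Suc n]" by (rule mset_set_set) simp
  finally have "image_mset Ks (mset S) \<subseteq># mset ?ys"
    by (simp add: image_mset_subseteq_mono del: upt_Suc)
  moreover have "sorted_wrt (\<ge>) ?ys" by (simp add: sorted_wrt_rev del: upt_Suc)
  ultimately have "sum_mset (image_mset Ks (mset S)) \<le> sum_list (take (length S) ?ys)"
    using sum_mset_le_sum_list_take by fastforce
  thus ?thesis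
    using assms(3) by (simp add: K_hat_def sum_mset_sum_list flip: mset_map)
qed

lemma self_adjoint_matrix:
  fixes A :: "real^'p^'p"
  assumes "transpose A = A"
  shows "self_adjoint ((*v) A)"
  unfolding self_adjoint_def
proof (intro conjI allI)
  fix x y
  have "(A *v x) \<bullet> y = (x v* A) \<bullet> y" using assms by (metis vector_transpose_matrix)
  thus "(A *v x) \<bullet> y = x \<bullet> (A *v y)" by (simp add: dot_lmul_matrix)
qed simp

lemma loewner_le_inner:
  assumes "A \<preceq> B"
  shows "v \<bullet> (A *v v) \<le> v \<bullet> (B *v v)"
proof -
  have "0 \<le> v \<bullet> ((B - A) *v v)" using assms by (simp add: loewner_le_def sym_psd_def)
  thus ?thesis by (simp add: matrix_vector_mult_diff_rdistrib inner_diff_right)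
qed

lemma inner_scaled_identity: "v \<bullet> ((c *\<^sub>R mat 1) *v v) = c * (v \<bullet> (v :: real^'p))"
  by (simp flip: scaleR_matrix_vector_assoc)

lemma sub_hessian_eq_sample_sum:
  "sub_hessian f S x *v v = (1 / real (length S)) *\<^sub>R sample_sum (\<lambda>i v. hessian (f i) x *v v) S v"
proof -
  have "(\<Sum>j\<leftarrow>S. hessian (f j) x) *v v = sample_sum (\<lambda>i v. hessian (f i) x *v v) S v"
    by (induction S) (simp_all add: sample_sum_def matrix_vector_mult_add_rdistrib)
  thus ?thesis by (simp add: sub_hessian_def flip: scaleR_matrix_vector_assoc)
qed

text \<open>With replacement every draw may hit the largest constant, so each is bounded by the
  maximum; distinct draws compete with the \<open>m\<close> largest values.\<close>

lemma sum_list_le_kappa_tilde: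
  assumes "S \<in> sample_lists mode n m" "0 < m" "0 < \<gamma>"
  shows "(\<Sum>i\<leftarrow>S. Ks i) \<le> real m * (kappa_tilde mode n Ks \<gamma> m * \<gamma>)"
proof (cases mode)
  case With_Replacement
  have "(\<Sum>i\<leftarrow>S. Ks i) \<le> (\<Sum>i\<leftarrow>S. K_hat n Ks 1)"
    using sample_listsD(2)[OF assms(1)] sum_list_le_K_hat[of "[i]" n Ks for i]
    by (intro sum_list_mono) auto
  thus ?thesis
    using With_Replacement assms sample_listsD(1)[OF assms(1)]
    by (simp add: kappa_q_def sum_list_triv)
next
  case Without_Replacement
  thus ?thesis
    using assms sum_list_le_K_hat[of S n Ks] by (auto simp: kappa_q_def)
qed

text \<open>The event ranges over all outcomes of the iteration, hence over every admissible
  direction. The step bound is a minimum with \<open>\<alpha>hat\<close> because \<alpha> is capped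
  there, while the other quantity comes close to 2 for \<open>K = \<gamma>\<close> and small
  \<open>\<theta>2\<close>, \<beta>, \<epsilon>.\<close>

theorem theorem3:
  fixes f :: "nat \<Rightarrow> real^'p \<Rightarrow> real"
    and n m :: nat
    and Ks :: "nat \<Rightarrow> real"
    and K \<gamma> \<theta>1 \<theta>2 \<delta> \<epsilon> \<beta> \<alpha>hat :: real
    and mode :: sampling
    and x xstar :: "real^'p"
  assumes "1 \<le> n"
    and "\<And>i. i \<in> {1..n} \<Longrightarrow> twice_differentiable (f i)"
    and "\<And>i. i \<in> {1..n} \<Longrightarrow> 0 < Ks i"
    and "\<And>i y. i \<in> {1..n} \<Longrightarrow> 0 \<preceq> hessian (f i) y"
    and "\<And>i y. i \<in> {1..n} \<Longrightarrow> hessian (f i) y \<preceq> Ks i *\<^sub>R mat 1"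
    and "0 < \<gamma>" and "\<gamma> \<le> K"
    and "\<And>y. \<gamma> *\<^sub>R mat 1 \<preceq> hessian (average n f) y"
    and "\<And>y. hessian (average n f) y \<preceq> K *\<^sub>R mat 1"
    and "\<And>y. average n f xstar \<le> average n f y"
    and "0 \<le> \<theta>1" and "\<theta>1 < 1"
    and "0 \<le> \<theta>2" and "\<theta>2 < 1"
    and "0 < \<delta>" and "\<delta> < 1"
    and "0 < \<epsilon>" and "\<epsilon> < 1"
    and "0 < \<beta>" and "\<beta> < 1"
    and "1 \<le> \<alpha>hat"
    and "real m \<ge> 2 * kappa_q n Ks \<gamma> 1 * ln (real CARD('p) / \<delta>) / \<epsilon>\<^sup>2"
    and "mode = Without_Replacement \<Longrightarrow> m \<le> n"
  shows "measure_pmf.prob (draw mode n m)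
           {S. \<forall>\<alpha> x'. newton_iteration n f \<theta>1 \<theta>2 \<beta> \<alpha>hat S x \<alpha> x' \<longrightarrow>
                 average n f x' - average n f xstar
                   \<le> (1 - rate \<theta>1 \<theta>2 \<epsilon> \<beta> (kappa_tilde mode n Ks \<gamma> m) \<alpha>)
                       * (average n f x - average n f xstar)
               \<and> \<alpha> \<ge> min \<alpha>hat (2 * (1 - \<theta>2) * (1 - \<beta>) * (1 - \<epsilon>) / (K / \<gamma>))}
         \<ge> 1 - \<delta>"
    (is "measure_pmf.prob ?D ?good \<ge> 1 - \<delta>")
proof -
  note f = assms(2) and Ks = assms(3) and m_ge = assms(22) and m_le = assms(23)
  define F where "F = average n f"
  define X where "X i v = hessian (f i) x *v v" for i v
  define R where "R = K_hat n Ks 1"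
  \<comment> \<open>The failure of \<open>(1 - \<epsilon>) * \<gamma>\<close> as a lower bound for
    the sampled Hessian, multiplied by the sample size.\<close>
  define bad where "bad = {S. \<exists>v. v \<bullet> sample_sum X S v < (1 - \<epsilon>) * real m * \<gamma> * (v \<bullet> v)}"
  have F: "twice_differentiable F"
    unfolding F_def by (rule twice_differentiable_average[of n f, OF f])
  have low: "\<gamma> * (v \<bullet> v) \<le> v \<bullet> (hessian F y *v v)" for y v
    using loewner_le_inner[OF assms(8), of v y] by (simp add: inner_scaled_identity F_def)
  have up: "v \<bullet> (hessian F y *v v) \<le> K * (v \<bullet> v)" for y v
    using loewner_le_inner[OF assms(9), of v y] by (simp add: inner_scaled_identity F_def)
  have X_self_adjoint: "self_adjoint (X i)" if "i \<in> {1..n}" for i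
  proof -
    have "transpose (hessian (f i) x) = hessian (f i) x"
      using assms(4)[OF that, of x] by (simp add: loewner_le_def sym_psd_def)
    thus ?thesis unfolding X_def[abs_def] by (rule self_adjoint_matrix)
  qed
  have X_psd: "0 \<le> v \<bullet> X i v" if "i \<in> {1..n}" for i v
    using loewner_le_inner[OF assms(4)[OF that], of v x] by (simp add: X_def)
  have X_up: "v \<bullet> X i v \<le> Ks i * (v \<bullet> v)" if "i \<in> {1..n}" for i v
    using loewner_le_inner[OF assms(5)[OF that], of v x] by (simp add: X_def inner_scaled_identity)
  have Ks_le: "Ks i \<le> R" if "i \<in> {1..n}" for i
    using sum_list_le_K_hat[of "[i]" n Ks] that by (simp add: R_def)
  have "0 < R" using Ks[of 1] Ks_le[of 1] \<open>1 \<le> n\<close> by simp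
  have X_square: "X i v \<bullet> X i v \<le> R * (v \<bullet> X i v)" if "i \<in> {1..n}" for i v
  proof (rule psd_norm_square_le[OF X_self_adjoint[OF that] X_psd[OF that] \<open>0 < R\<close>])
    fix v
    show "v \<bullet> X i v \<le> R * (v \<bullet> v)"
      using X_up[OF that, of v] mult_right_mono[OF Ks_le[OF that], of "v \<bullet> v"] by simp
  qed
  have X_mean: "real n * \<gamma> * (v \<bullet> v) \<le> (\<Sum>i=1..n. v \<bullet> X i v)" for v
  proof -
    have "hessian F x *v v = (1 / real n) *\<^sub>R (\<Sum>i=1..n. X i v)"
      unfolding F_def X_def using f by (rule hessian_average)
    hence "v \<bullet> (hessian F x *v v) = (1 / real n) * (\<Sum>i=1..n. v \<bullet> X i v)"
      by (simp add: inner_sum_right)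
    hence "(\<Sum>i=1..n. v \<bullet> X i v) = real n * (v \<bullet> (hessian F x *v v))"
      using \<open>1 \<le> n\<close> by simp
    thus ?thesis using low[of v x] by (simp add: mult.assoc mult_left_mono)
  qed
  \<comment> \<open>Positivity of the logarithm makes the sample nonempty, so its average is a
    genuine one.\<close>
  have ln_pos: "0 < ln (real CARD('p) / \<delta>)"
  proof -
    have "1 \<le> real CARD('p)" using one_le_card_finite[where 'a = 'p] by linarith
    hence "\<delta> < real CARD('p)" using assms(16) by (rule less_le_trans[rotated])
    thus ?thesis using assms(15) by simp
  qed
  have m_ge': "2 * R * ln (real CARD('p) / \<delta>) / (\<gamma> * \<epsilon>\<^sup>2) \<le> real m"
    using m_ge by (simp add: kappa_q_def R_def)
  moreover have "0 < 2 * R * ln (real CARD('p) / \<delta>) / (\<gamma> * \<epsilon>\<^sup>2)"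
    using ln_pos \<open>0 < R\<close> assms(6,17) by simp
  ultimately have "0 < m" by linarith
  have good: "S \<in> ?good" if S: "S \<in> sample_lists mode n m" "S \<notin> bad" for S
  proof -
    let ?H = "sub_hessian f S x"
    define L where "L = kappa_tilde mode n Ks \<gamma> m * \<gamma>"
    note len = sample_listsD(1)[OF S(1)]
    have range: "i \<in> {1..n}" if "i \<in> set S" for i
      using sample_listsD(2)[OF S(1)] that by blast
    have Hv: "?H *v v = (1 / real m) *\<^sub>R sample_sum X S v" for v
      by (simp add: sub_hessian_eq_sample_sum len X_def[abs_def])
    have H: "self_adjoint ((*v) ?H)"
      unfolding Hv[abs_def]
      by (intro self_adjoint_scale self_adjoint_sample_sum X_self_adjoint range)
    have sum_le: "real m * L \<ge> (\<Sum>i\<leftarrow>S. Ks i)"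
      unfolding L_def using S(1) \<open>0 < m\<close> assms(6) by (rule sum_list_le_kappa_tilde)
    \<comment> \<open>A nonempty sample has a positive sum of constants, which forces
      \<open>L\<close> to be positive.\<close>
    obtain i S' where S': "S = i # S'" using len \<open>0 < m\<close> by (cases S) auto
    have pos: "0 < Ks j" if "j \<in> set S" for j using Ks range that by blast
    have "0 < Ks i" using pos by (simp add: S')
    moreover have "0 \<le> (\<Sum>j\<leftarrow>S'. Ks j)"
      by (rule sum_list_nonneg) (use pos S' in \<open>fastforce intro: less_imp_le\<close>)
    ultimately have "0 < (\<Sum>i\<leftarrow>S. Ks i)" by (simp add: S')
    with sum_le \<open>0 < m\<close> have "0 < real m * L" "0 < real m" by simp_all
    hence "0 < L" by (simp only: zero_less_mult_pos)
    have Hlow: "(1 - \<epsilon>) * \<gamma> * (v \<bullet> v) \<le> v \<bullet> (?H *v v)" for v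
    proof -
      have "(1 - \<epsilon>) * real m * \<gamma> * (v \<bullet> v) \<le> v \<bullet> sample_sum X S v"
        using S(2) by (auto simp: bad_def not_less)
      thus ?thesis using \<open>0 < m\<close> by (simp add: Hv field_simps)
    qed
    have Hup: "v \<bullet> (?H *v v) \<le> L * (v \<bullet> v)" for v
    proof -
      have "v \<bullet> sample_sum X S v = (\<Sum>i\<leftarrow>S. v \<bullet> X i v)"
        unfolding sample_sum_def by (induction S) (simp_all add: inner_add_right)
      also have "\<dots> \<le> (\<Sum>i\<leftarrow>S. Ks i * (v \<bullet> v))"
        by (intro sum_list_mono X_up range)
      also have "\<dots> = (\<Sum>i\<leftarrow>S. Ks i) * (v \<bullet> v)" by (rule sum_list_mult_const)
      also have "\<dots> \<le> real m * L * (v \<bullet> v)" using sum_le by (intro mult_right_mono) auto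
      finally show ?thesis using \<open>0 < m\<close> by (simp add: Hv field_simps)
    qed
    have kt: "kappa_tilde mode n Ks \<gamma> m = L / \<gamma>" using assms(6) by (simp add: L_def)
    show ?thesis
    proof (intro CollectI allI impI)
      fix \<alpha> x' assume "newton_iteration n f \<theta>1 \<theta>2 \<beta> \<alpha>hat S x \<alpha> x'"
      then obtain p where p: "inexact_direction \<theta>1 \<theta>2 ?H (grad F x) p"
        "armijo_step F \<beta> \<alpha>hat x p \<alpha>" and x': "x' = x + \<alpha> *\<^sub>R p"
        by (auto simp: newton_iteration_def F_def)
      have "0 < K" "0 < \<alpha>hat" "\<And>y. F xstar \<le> F y" using assms by (auto simp: F_def)
      note bounds = newton_iteration_bounds[OF F assms(6) this(1) low up this(3) H \<open>0 < L\<close> Hlow Hup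
          assms(11,12,14,19,20,18) this(2) p]
      show "average n f x' - average n f xstar
            \<le> (1 - rate \<theta>1 \<theta>2 \<epsilon> \<beta> (kappa_tilde mode n Ks \<gamma> m) \<alpha>)
                * (average n f x - average n f xstar)
          \<and> min \<alpha>hat (2 * (1 - \<theta>2) * (1 - \<beta>) * (1 - \<epsilon>) / (K / \<gamma>)) \<le> \<alpha>"
        unfolding kt x' F_def[symmetric] using bounds by blast
    qed
  qed
  have "measure_pmf.prob ?D (- ?good) \<le> measure_pmf.prob ?D bad"
  proof -
    have "set_pmf ?D = sample_lists mode n m"
      using sample_lists_nonempty[OF assms(1)] m_le finite_sample_lists
      by (simp add: draw_def set_pmf_of_set)
    \<comment> \<open>Only lists that can be drawn are known to be good or bad, so the events are
      compared on the support.\<close>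
    hence "- ?good \<inter> set_pmf ?D \<subseteq> bad" using good by blast
    hence "measure_pmf.prob ?D (- ?good \<inter> set_pmf ?D) \<le> measure_pmf.prob ?D bad"
      by (intro measure_pmf.finite_measure_mono) auto
    thus ?thesis by (simp add: measure_Int_set_pmf)
  qed
  also have "\<dots> \<le> DIM(real^'p) * exp (- (real m * \<gamma> * \<epsilon>\<^sup>2 / (2 * R)))"
    unfolding bad_def
    by (rule sampling_chernoff_lower_tail[OF assms(1) X_self_adjoint \<open>0 < R\<close> X_square X_mean
          assms(17,18) m_le])
  \<comment> \<open>The sample size is chosen so that the Chernoff exponent reaches
    \<open>ln (real CARD('p) / \<delta>)\<close>, which absorbs the dimension and leaves
    \<delta>.\<close>
  also have "\<dots> \<le> DIM(real^'p) * exp (- ln (real CARD('p) / \<delta>))"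
    using m_ge' \<open>0 < R\<close> assms(6,17) by (intro mult_left_mono) (simp_all add: field_simps)
  also have "\<dots> = \<delta>" using assms(15) by (simp add: exp_minus)
  finally have "measure_pmf.prob ?D (- ?good) \<le> \<delta>" .
  thus ?thesis using measure_pmf.prob_compl[of ?good ?D] by (simp add: Compl_eq_Diff_UNIV)
qed

end
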